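(* Let $S\subset\mathbb{R}^2$ be the von Koch snowflake (the bounded open region enclosed by the von Koch snowflake curve $\Sigma$, so that $\partial S=\Sigma$). Then \[ P_s(S)<\infty\quad\text{for every } s\in\Big(0,2-\tfrac{\log 4}{\log 3}\Big),\qquad P_s(S)=\infty\quad\text{for every } s\in\Big[2-\tfrac{\log 4}{\log 3},1\Big). \] Consequently \[ \mathrm{Dim}_F(\partial S)=\mathrm{Dim}_{\mathcal M}(\partial S)=\frac{\log 4}{\log 3}. \]
   Context: For $s\in(0,1)$ and disjoint measurable $A,B\subset\mathbb{R}^n$ set $\mathcal L_s(A,B):=\int_A\int_B|x-y|^{-n-s}\,dx\,dy$. For an open set $\Omega$ and $E\subset\mathbb{R}^n$, the $s$-perimeter of $E$ in $\Omega$ is $P_s(E,\Omega):=\mathcal L_s(E\cap\Omega,E^c\cap\Omega)+\mathcal L_s(E\cap\Omega,E^c\setminus\Omega)+\mathcal L_s(E\setminus\Omega,E^c\cap\Omega)$, its local part is $P_s^L(E,\Omega):=\mathcal L_s(E\cap\Omega,E^c\cap\Omega)$, and $P_s(E):=P_s(E,\mathbb{R}^n)=\mathcal L_s(E,E^c)$. The measure theoretic boundary is $\partial^-E:=\{x\in\mathbb{R}^n: 0<|E\cap B_r(x)|<\omega_n r^n \text{ for all } r>0\}$ (for $S$ one has $\partial^-S=\partial S$). If $\partial^-E\cap\Omega\neq\emptyset$, the fractal dimension is $\mathrm{Dim}_F(\partial^-E,\Omega):=n-\sup\{s\in(0,1): P_s^L(E,\Omega)<\infty\}$, and $\mathrm{Dim}_F(\partial^-E):=\mathrm{Dim}_F(\partial^-E,\mathbb{R}^n)$.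 $\mathrm{Dim}_{\mathcal M}$ denotes the Minkowski (box-counting) dimension, i.e. the common value of the lower and upper Minkowski dimensions $\liminf/\limsup_{\delta\to0}\log\mathcal N(\Gamma,\delta)/(-\log\delta)$, where $\mathcal N(\Gamma,\delta)$ is the minimal number of $\delta$-balls covering $\Gamma$. The von Koch curve is the limit of the polygonal curves $\Gamma_k$, where $\Gamma_0$ is a unit segment and $\Gamma_k$ is obtained from $\Gamma_{k-1}$ by replacing the middle third of each segment by the other two sides of the equilateral triangle built on it (pointing outward); the snowflake curve $\Sigma$ is obtained by performing this construction on the three sides of an equilateral triangle of unit side. *)

theory Defs
  imports "HOL-Analysis.Analysis"
begin

definition L_s :: "real \<Rightarrow> 'a::euclidean_space set \<Rightarrow> 'a set \<Rightarrow> ennreal" where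
  "L_s s A B = (\<integral>\<^sup>+ x. (\<integral>\<^sup>+ y. ennreal (dist x y powr (- (real DIM('a) + s))) * indicator B y \<partial>lborel)
                   * indicator A x \<partial>lborel)"

definition s_perimeter_in :: "real \<Rightarrow> 'a::euclidean_space set \<Rightarrow> 'a set \<Rightarrow> ennreal" where
  "s_perimeter_in s E \<Omega> =
     L_s s (E \<inter> \<Omega>) (- E \<inter> \<Omega>) + L_s s (E \<inter> \<Omega>) (- E - \<Omega>) + L_s s (E - \<Omega>) (- E \<inter> \<Omega>)"

definition local_s_perimeter :: "real \<Rightarrow> 'a::euclidean_space set \<Rightarrow> 'a set \<Rightarrow> ennreal" where
  "local_s_perimeter s E \<Omega> = L_s s (E \<inter> \<Omega>) (- E \<inter> \<Omega>)"

definition s_perimeter :: "real \<Rightarrow> 'a::euclidean_space set \<Rightarrow> ennreal" where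
  "s_perimeter s E = s_perimeter_in s E UNIV"

definition measure_boundary :: "'a::euclidean_space set \<Rightarrow> 'a set" where
  "measure_boundary E = {x. \<forall>r>0. 0 < measure lborel (E \<inter> ball x r)
                                 \<and> measure lborel (E \<inter> ball x r) < measure lborel (ball x r)}"

definition fractal_dim_in :: "'a::euclidean_space set \<Rightarrow> 'a set \<Rightarrow> real" where
  "fractal_dim_in E \<Omega> = real DIM('a) - Sup {s. 0 < s \<and> s < 1 \<and> local_s_perimeter s E \<Omega> < \<infinity>}"

definition fractal_dim :: "'a::euclidean_space set \<Rightarrow> real" where
  "fractal_dim E = fractal_dim_in E UNIV"

definition covering_number :: "'a::metric_space set \<Rightarrow> real \<Rightarrow> nat" where
  "covering_number \<Gamma> \<delta> = Inf {card C | C. finite C \<and> \<Gamma> \<subseteq> (\<Union>c\<in>C. ball c \<delta>)}"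

definition lower_minkowski_dim :: "'a::metric_space set \<Rightarrow> ereal" where
  "lower_minkowski_dim \<Gamma> = Liminf (at_right 0) (\<lambda>\<delta>. ereal (ln (real (covering_number \<Gamma> \<delta>)) / (- ln \<delta>)))"

definition upper_minkowski_dim :: "'a::metric_space set \<Rightarrow> ereal" where
  "upper_minkowski_dim \<Gamma> = Limsup (at_right 0) (\<lambda>\<delta>. ereal (ln (real (covering_number \<Gamma> \<delta>)) / (- ln \<delta>)))"

text \<open>Replace the middle third of the segment from a to b by the other two sides
  of the equilateral triangle built on it; for a counterclockwise oriented
  polygon the outward side is the right-hand side (rotation by -pi/3).\<close>
definition koch_refine :: "complex \<times> complex \<Rightarrow> (complex \<times> complex) list" where
  "koch_refine ab = (let a = fst ab; b = snd ab; d = (b - a) / 3;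
                        p = a + d; q = a + 2 * d; r = p + d * cis (- pi / 3)
                     in [(a, p), (p, r), (r, q), (q, b)])"

definition koch_step :: "(complex \<times> complex) list \<Rightarrow> (complex \<times> complex) list" where
  "koch_step L = concat (map koch_refine L)"

definition snowflake_polygon :: "nat \<Rightarrow> (complex \<times> complex) list" where
  "snowflake_polygon k = (koch_step ^^ k) [(0, 1), (1, cis (pi / 3)), (cis (pi / 3), 0)]"

definition polygon_set :: "(complex \<times> complex) list \<Rightarrow> complex set" where
  "polygon_set L = (\<Union>ab\<in>set L. closed_segment (fst ab) (snd ab))"

text \<open>The snowflake curve: the limit of the polygonal curves Gamma_k (Kuratowski
  lower limit, which coincides with the Hausdorff limit here).\<close>
definition snowflake_curve :: "complex set" where
  "snowflake_curve = {x. \<exists>X. (\<forall>k. X k \<in> polygon_set (snowflake_polygon k)) \<and> X \<longlonglongrightarrow> x}"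

definition snowflake :: "complex set" where
  "snowflake = inside snowflake_curve"

end

theory Submission
  imports Defs "HOL-Complex_Analysis.Winding_Numbers"
begin

text \<open>The snowflake curve is a union of three Koch curves, and each Koch curve is the attractor of four
  similarities of ratio \<open>1/3\<close>. The images of a thin rhombus around the unit segment are nested, and those
  of its open interior at any one level are disjoint. Every image contains, at a scale comparable to
  its own size, a ball inside and a ball outside the curve: outer parts of a piece are joined to the
  exterior of a regular hexagon level by level, inner parts are joined to the centre of the initial
  triangle, and the centre is enclosed because approximating polygons wind around it. Hence the
  \<open>4^k\<close> pieces of level \<open>k\<close> contribute at least a constant multiple of \<open>4^k * 3^(- (2 - s) * k)\<close> to the
  perimeter, which does not tend to 0 when \<open>s \<ge> 2 - ln 4 / ln 3\<close>. Conversely, a pair of points on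
  different sides at distance about \<open>3^(- k)\<close> lies within \<open>3^(- k)\<close> of the curve, a set of measure
  \<open>O((4/9)^k)\<close>, which bounds the perimeter by a geometric series of ratio \<open>4 * 3^(s - 2)\<close>. Covering by the
  pieces and separating boundary points of distinct pieces gives the box dimension.\<close>

text \<open>The region is the \<open>inside\<close> of a limit curve that is never parametrised, so
  the side on which a point lies has to be found by connecting it to points already decided. The
  device is \<open>piece_in_koch3_iff\<close>: in the image of the closed rhombus under any piece,
  the whole curve is just the image of the unit Koch curve. A segment that avoids
  \<open>koch\<close> in the unit rhombus can therefore be copied into every piece, and a few
  explicit segments carry the inside and the outside through all levels. A global argument, by
  winding numbers, is made at a single point only, the centre. At the critical exponent every level
  has the same lower bound, so the contributions of different levels must add up. This asks for
  inner balls that are disjoint across levels too, and is why \<open>inpt\<close> is placed where no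
  smaller piece reaches. Both halves of the dichotomy are governed by 4 * 3^(s - 2), which equals 1
  exactly at s = 2 - ln 4 / ln 3.\<close>

section \<open>The linear geometry of one Koch step\<close>

text \<open>In the coordinates \<open>Re\<close> and \<open>sqrt 3 * Im\<close> all maps of the construction have rational
  coefficients, so that the relative position of the pieces is decided by linear arithmetic.\<close>

definition sIm :: "complex \<Rightarrow> real" where
  "sIm z = sqrt 3 * Im z"

lemma sIm_add [simp]: "sIm (x + y) = sIm x + sIm y"
  and sIm_diff [simp]: "sIm (x - y) = sIm x - sIm y"
  and sIm_uminus [simp]: "sIm (- x) = - sIm x"
  and sIm_scaleR [simp]: "sIm (r *\<^sub>R x) = r * sIm x"
  and sIm_of_real [simp]: "sIm (of_real r) = 0"
  and sIm_numeral [simp]: "sIm (numeral n) = 0"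
  and sIm_0 [simp]: "sIm 0 = 0"
  and sIm_1 [simp]: "sIm 1 = 0"
  and sIm_divide_numeral [simp]: "sIm (x / numeral n) = sIm x / numeral n"
  by (simp_all add: sIm_def algebra_simps)

lemma complex_eq_iff_sIm: "x = y \<longleftrightarrow> Re x = Re y \<and> sIm x = sIm y"
  by (simp add: sIm_def complex_eq_iff)

lemma norm_sIm: "(norm z)\<^sup>2 = (Re z)\<^sup>2 + (sIm z)\<^sup>2 / 3"
  by (simp add: sIm_def cmod_power2 power_mult_distrib)

lemma abs_sIm_le: "\<bar>sIm z\<bar> \<le> 2 * norm z"
proof -
  have "sqrt 3 \<le> 2" by (rule real_le_lsqrt) auto
  then show ?thesis unfolding sIm_def abs_mult
    using abs_Im_le_cmod[of z] by (intro mult_mono) auto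
qed

lemma continuous_on_sIm [continuous_intros]:
  "continuous_on A f \<Longrightarrow> continuous_on A (\<lambda>x. sIm (f x))"
  unfolding sIm_def by (intro continuous_intros)

lemma convex_sIm_le: "convex {z. a * Re z + b * sIm z \<le> c}"
proof -
  have "{z. a * Re z + b * sIm z \<le> c} = {z. inner (Complex a (b * sqrt 3)) z \<le> c}"
    by (simp add: inner_complex_def sIm_def mult_ac)
  then show ?thesis by (simp add: convex_halfspace_le)
qed

lemma closed_sIm_le: "closed {z. a * Re z + b * sIm z \<le> c}"
  by (intro closed_Collect_le continuous_intros)

text \<open>The similarities taking the directed unit segment to the four edges made by
  \<open>koch_refine\<close>, in order; the bump points below the real axis, to the right of the
  segment.\<close>

definition kf :: "nat \<Rightarrow> complex \<Rightarrow> complex" where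
  "kf i z = (if i = 0 then z / 3
    else if i = 1 then 1 / 3 + cis (- pi / 3) * z / 3
    else if i = 2 then 1 / 3 + cis (- pi / 3) / 3 + cis (pi / 3) * z / 3
    else 2 / 3 + z / 3)"

text \<open>Isometries taking the directed unit segment to the counterclockwise sides of the initial
  triangle, so that the lower half-plane becomes the outward side. The factor
  \<open>cis (pi / 3) - 1\<close> is the rotation by 2 pi / 3.\<close>

definition side :: "nat \<Rightarrow> complex \<Rightarrow> complex" where
  "side j z = (if j = 0 then z
    else if j = 1 then 1 + (cis (pi / 3) - 1) * z
    else cis (pi / 3) - cis (pi / 3) * z)"

lemma cis_mult_coords:
  "Re (cis (pi / 3) * z) = (Re z - sIm z) / 2"
  "sIm (cis (pi / 3) * z) = (sIm z + 3 * Re z) / 2"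
  "Re (cis (- pi / 3) * z) = (Re z + sIm z) / 2"
  "sIm (cis (- pi / 3) * z) = (sIm z - 3 * Re z) / 2"
  "Re (cis (- (pi / 3)) * z) = (Re z + sIm z) / 2"
  "sIm (cis (- (pi / 3)) * z) = (sIm z - 3 * Re z) / 2"
  "Re (cis (pi / 3)) = 1 / 2" "sIm (cis (pi / 3)) = 3 / 2"
  "Re (cis (- pi / 3)) = 1 / 2" "sIm (cis (- pi / 3)) = - 3 / 2"
  "Re (cis (- (pi / 3))) = 1 / 2" "sIm (cis (- (pi / 3))) = - 3 / 2"
  by (simp_all add: sIm_def cos_60 sin_60 algebra_simps)

lemma kf_coords:
  "Re (kf 0 z) = Re z / 3" "sIm (kf 0 z) = sIm z / 3"
  "Re (kf (Suc 0) z) = 1 / 3 + Re z / 6 + sIm z / 6" "sIm (kf (Suc 0) z) = sIm z / 6 - Re z / 2"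
  "Re (kf 2 z) = 1 / 2 + Re z / 6 - sIm z / 6" "sIm (kf 2 z) = sIm z / 6 + Re z / 2 - 1 / 2"
  "Re (kf 3 z) = 2 / 3 + Re z / 3" "sIm (kf 3 z) = sIm z / 3"
  by (simp_all add: kf_def sIm_def cos_60 sin_60 field_simps)

lemma side_coords:
  "Re (side 0 z) = Re z" "sIm (side 0 z) = sIm z"
  "Re (side (Suc 0) z) = 1 - Re z / 2 - sIm z / 2" "sIm (side (Suc 0) z) = 3 / 2 * Re z - sIm z / 2"
  "Re (side 2 z) = 1 / 2 - Re z / 2 + sIm z / 2" "sIm (side 2 z) = 3 / 2 - 3 / 2 * Re z - sIm z / 2"
  by (simp_all add: side_def sIm_def cos_60 sin_60 field_simps)

lemma less_4_iff: "i < 4 \<longleftrightarrow> i = 0 \<or> i = Suc 0 \<or> i = 2 \<or> i = (3::nat)"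
  by auto

lemma less_3_iff: "j < 3 \<longleftrightarrow> j = 0 \<or> j = Suc 0 \<or> j = (2::nat)"
  by auto

text \<open>The closed rhombus with long diagonal from 0 to 1 and angles \<open>pi/3\<close> there; its outer half
  (below the diagonal) contains the Koch curve on that segment.\<close>

definition rhomb :: "complex set" where
  "rhomb = {z. sIm z \<le> Re z \<and> - sIm z \<le> Re z \<and> sIm z \<le> 1 - Re z \<and> - sIm z \<le> 1 - Re z}"

definition orhomb :: "complex set" where
  "orhomb = {z. sIm z < Re z \<and> - sIm z < Re z \<and> sIm z < 1 - Re z \<and> - sIm z < 1 - Re z}"

definition outer_tri :: "complex set" where
  "outer_tri = {z \<in> rhomb. sIm z \<le> 0}"

definition outer_edges :: "complex set" where
  "outer_edges = {z \<in> rhomb. sIm z = - Re z \<or> sIm z = Re z - 1}"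

text \<open>The base is left out because the Koch curve has points on it; this makes the set
  disjoint from \<open>koch\<close>.\<close>

definition inner_tri :: "complex set" where
  "inner_tri = {z \<in> rhomb. 0 < sIm z}"

lemma rhomb_halfspaces:
  "rhomb = {z. (-1) * Re z + 1 * sIm z \<le> 0} \<inter> {z. (-1) * Re z + (-1) * sIm z \<le> 0}
     \<inter> {z. 1 * Re z + 1 * sIm z \<le> 1} \<inter> {z. 1 * Re z + (-1) * sIm z \<le> 1}"
  by (auto simp: rhomb_def)

lemma outer_tri_halfspaces:
  "outer_tri = rhomb \<inter> {z. 0 * Re z + 1 * sIm z \<le> 0}"
  by (auto simp: outer_tri_def)

lemma convex_rhomb: "convex rhomb"
  unfolding rhomb_halfspaces by (intro convex_Int convex_sIm_le)

lemma convex_outer_tri: "convex outer_tri"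
  unfolding outer_tri_halfspaces by (intro convex_Int convex_sIm_le convex_rhomb)

lemma closed_outer_tri: "closed outer_tri"
  unfolding outer_tri_halfspaces rhomb_halfspaces by (intro closed_Int closed_sIm_le)

lemma outer_tri_rhomb: "outer_tri \<subseteq> rhomb"
  by (auto simp: outer_tri_def)

lemma norm_rhomb:
  assumes "z \<in> rhomb"
  shows "norm z \<le> 1"
proof -
  have z: "0 \<le> Re z" "Re z \<le> 1" "\<bar>sIm z\<bar> \<le> 1 - Re z"
    using assms by (auto simp: rhomb_def)
  have "(sIm z)\<^sup>2 \<le> (1 - Re z)\<^sup>2"
    using power_mono[OF z(3), of 2] by simp
  then have "(norm z)\<^sup>2 \<le> (Re z)\<^sup>2 + (1 - Re z)\<^sup>2"
    unfolding norm_sIm using zero_le_power2[of "1 - Re z"] by linarith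
  also have "\<dots> = 1 - 2 * (Re z * (1 - Re z))" by (simp add: power2_eq_square algebra_simps)
  also have "\<dots> \<le> 1" using z by simp
  finally show ?thesis using power2_le_imp_le[of "norm z" 1] by simp
qed

lemma norm_outer_tri: "z \<in> outer_tri \<Longrightarrow> norm z \<le> 1"
  using norm_rhomb outer_tri_rhomb by blast

section \<open>Complex-affine maps\<close>

text \<open>The maps z -> a + b z, with coefficients read off from the values at 0 and 1; the
  scaling factor is then \<open>dist (f 0) (f 1)\<close>.\<close>

definition is_affine :: "(complex \<Rightarrow> complex) \<Rightarrow> bool" where
  "is_affine f \<longleftrightarrow> (\<forall>z. f z = f 0 + (f 1 - f 0) * z)"

lemma is_affineI: "(\<And>z. f z = a + b * z) \<Longrightarrow> is_affine f"
  by (simp add: is_affine_def)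

lemma is_affineE:
  assumes "is_affine f"
  obtains a b where "f = (\<lambda>z. a + b * z)"
  using assms unfolding is_affine_def by (metis ext)

lemma is_affine_comp:
  assumes "is_affine f" "is_affine g"
  shows "is_affine (f \<circ> g)"
proof -
  obtain a b c d where "f = (\<lambda>z. a + b * z)" "g = (\<lambda>z. c + d * z)"
    using assms by (metis is_affineE)
  then show ?thesis
    by (intro is_affineI[of _ "a + b * c" "b * d"]) (simp add: algebra_simps)
qed

lemma is_affine_kf: "is_affine (kf i)"
  by (rule is_affineI[of _ "kf i 0" "if i = 0 then 1/3 else if i = 1 then cis (- pi / 3) / 3
     else if i = 2 then cis (pi / 3) / 3 else 1/3"]) (simp add: kf_def)

lemma is_affine_side: "is_affine (side i)"
  by (rule is_affineI[of _ "side i 0" "if i = 0 then 1 else if i = 1 then cis (pi / 3) - 1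
     else - cis (pi / 3)"]) (simp add: side_def)

lemma is_affine_id: "is_affine id"
  by (simp add: is_affine_def)

lemma is_affine_dist:
  assumes "is_affine f"
  shows "dist (f x) (f y) = dist (f 0) (f 1) * dist x y"
proof -
  obtain a b where f: "f = (\<lambda>z. a + b * z)" using assms by (rule is_affineE)
  have "a + b * x - (a + b * y) = b * (x - y)" by (simp add: algebra_simps)
  then show ?thesis by (simp add: f dist_norm norm_mult)
qed

lemma is_affine_scaled:
  assumes "is_affine f"
  shows "f ((1 - u) *\<^sub>R x + u *\<^sub>R y) = (1 - u) *\<^sub>R f x + u *\<^sub>R f y"
proof -
  obtain a b where f: "f = (\<lambda>z. a + b * z)" using assms by (rule is_affineE)
  show ?thesis unfolding f by (simp add: algebra_simps scaleR_conv_of_real)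
qed

lemma is_affine_segment:
  assumes "is_affine f"
  shows "f ` closed_segment x y = closed_segment (f x) (f y)"
  unfolding closed_segment_image_interval image_image by (simp only: is_affine_scaled[OF assms])

lemma is_affine_convex:
  assumes "is_affine f" "convex S"
  shows "convex (f ` S)"
  unfolding convex_contains_segment
  using assms(2) unfolding convex_contains_segment
  by (auto simp flip: is_affine_segment[OF assms(1)])

lemma is_affine_continuous:
  assumes "is_affine f"
  shows "continuous_on S f"
proof -
  obtain a b where f: "f = (\<lambda>z. a + b * z)" using assms by (rule is_affineE)
  show ?thesis unfolding f by (intro continuous_intros)
qed

lemma dist_kf_01: "i < 4 \<Longrightarrow> dist (kf i 0) (kf i 1) = 1 / 3"
  by (auto simp: kf_def dist_norm norm_divide)

lemma dist_side_01:
  assumes "j < 3" shows "dist (side j 0) (side j 1) = 1"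
proof -
  have "norm (cis (pi / 3) - 1) = 1"
    using norm_sIm[of "cis (pi/3) - 1"]
    by (simp add: cis_mult_coords abs_square_eq_1 power_divide del: cis.sel)
  then show ?thesis using assms by (auto simp: less_3_iff side_def dist_norm norm_minus_commute)
qed

lemma dist_kf: "i < 4 \<Longrightarrow> dist (kf i x) (kf i y) = dist x y / 3"
  using is_affine_dist[OF is_affine_kf, of i x y] dist_kf_01[of i] by simp

lemma dist_side: "i < 3 \<Longrightarrow> dist (side i x) (side i y) = dist x y"
  using is_affine_dist[OF is_affine_side, of i x y] dist_side_01[of i] by simp

lemma kf_eq_iff: "i < 4 \<Longrightarrow> kf i x = kf i y \<longleftrightarrow> x = y"
  using dist_kf[of i x y] by auto

lemma side_eq_iff: "i < 3 \<Longrightarrow> side i x = side i y \<longleftrightarrow> x = y"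
  using dist_side[of i x y] by auto

lemma affine_ball:
  assumes f: "is_affine f" and d: "dist (f 0) (f 1) = c" "c > 0"
  shows "f ` ball x e = ball (f x) (c * e)"
proof (rule set_eqI, rule iffI)
  fix y assume "y \<in> f ` ball x e"
  then obtain z where "y = f z" "dist x z < e" by auto
  then show "y \<in> ball (f x) (c * e)"
    using is_affine_dist[OF f, of x z] d by simp
next
  fix y assume y: "y \<in> ball (f x) (c * e)"
  have nz: "f 1 - f 0 \<noteq> 0" using d by auto
  define z where "z = (y - f 0) / (f 1 - f 0)"
  have "f z = f 0 + (f 1 - f 0) * z" using f unfolding is_affine_def by blast
  then have fz: "f z = y" using nz by (simp add: z_def)
  then have "z \<in> ball x e"
    using y d(2) is_affine_dist[OF f, of x z] unfolding d(1) by simp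
  then show "y \<in> f ` ball x e" using fz by blast
qed

section \<open>Relative position of the images of the rhombus\<close>

lemma kf_outer_tri: "i < 4 \<Longrightarrow> z \<in> outer_tri \<Longrightarrow> kf i z \<in> outer_tri"
  unfolding less_4_iff outer_tri_def rhomb_def mem_Collect_eq
  by (elim conjE disjE; simp only: kf_coords; intro conjI; linarith)

lemma kf_rhomb: "i < 4 \<Longrightarrow> z \<in> rhomb \<Longrightarrow> kf i z \<in> rhomb"
  unfolding less_4_iff rhomb_def mem_Collect_eq
  by (elim conjE disjE; simp only: kf_coords; intro conjI; linarith)

lemma kf_orhomb: "i < 4 \<Longrightarrow> z \<in> orhomb \<Longrightarrow> kf i z \<in> orhomb"
  unfolding less_4_iff orhomb_def mem_Collect_eq
  by (elim conjE disjE; simp only: kf_coords; intro conjI; linarith)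

text \<open>At the tip of the bump two segments meet at the angle pi / 3, which two half-angles pi /
  6 fill exactly: the images 1 and 2 of the closed rhombus share an edge, and only the open ones are
  disjoint.\<close>

lemma kf_orhomb_disjoint:
  assumes ij: "i < 4" "j < 4" "i \<noteq> j" and xy: "x \<in> orhomb" "y \<in> orhomb"
  shows "kf i x \<noteq> kf j y"
proof
  assume "kf i x = kf j y"
  then have e: "Re (kf i x) = Re (kf j y)" "sIm (kf i x) = sIm (kf j y)" by auto
  from ij consider
      "i = 0 \<and> j = Suc 0 \<or> i = Suc 0 \<and> j = 0 \<or> i = Suc 0 \<and> j = 2 \<or> i = 2 \<and> j = Suc 0"
    | "i = 2 \<and> j = 3 \<or> i = 3 \<and> j = 2 \<or> i = 0 \<and> j = 2 \<or> i = 0 \<and> j = 3"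
    | "i = Suc 0 \<and> j = 3 \<or> i = 2 \<and> j = 0 \<or> i = 3 \<and> j = 0 \<or> i = 3 \<and> j = Suc 0"
    unfolding less_4_iff by (elim disjE) auto
  then show False
    using e xy unfolding orhomb_def mem_Collect_eq
    by cases (elim conjE disjE; hypsubst; simp (no_asm_use) only: kf_coords; linarith)+
qed

text \<open>Because of the inner edge shared at the tip, one of the two points is confined to the
  outer half, where the curve lies. The images then meet at most in the common endpoint of
  consecutive segments.\<close>

lemma kf_rhomb_touch:
  assumes ij: "i < 4" "j < 4" "i \<noteq> j" and x: "x \<in> rhomb" and y: "y \<in> outer_tri"
    and eq: "kf i x = kf j y"
  shows "x = 0 \<or> x = 1"
proof -
  have e: "Re (kf i x) = Re (kf j y)" "sIm (kf i x) = sIm (kf j y)" using eq by auto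
  \<comment> \<open>If \<open>j\<close> follows \<open>i\<close>, the common point is the end of
    piece \<open>i\<close>; if \<open>j\<close> precedes \<open>i\<close>, it is the start; all
    other pairs do not meet.\<close>
  from ij consider
      "i = 0 \<and> j = Suc 0 \<or> i = Suc 0 \<and> j = 2 \<or> i = 2 \<and> j = 3"
    | "i = Suc 0 \<and> j = 0 \<or> i = 2 \<and> j = Suc 0 \<or> i = 3 \<and> j = 2"
    | "i = 0 \<and> j = 2 \<or> i = 0 \<and> j = 3 \<or> i = Suc 0 \<and> j = 3 \<or> 
       i = 2 \<and> j = 0 \<or> i = 3 \<and> j = 0 \<or> i = 3 \<and> j = Suc 0"
    unfolding less_4_iff by (elim disjE) auto
  then have "Re x = 0 \<and> sIm x = 0 \<or> Re x = 1 \<and> sIm x = 0"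
  proof cases
    case 1
    then have "Re x = 1 \<and> sIm x = 0" using e x y
      unfolding outer_tri_def rhomb_def mem_Collect_eq
      by (elim conjE disjE; hypsubst; simp (no_asm_use) only: kf_coords; intro conjI; linarith)
    then show ?thesis ..
  next
    case 2
    then have "Re x = 0 \<and> sIm x = 0" using e x y
      unfolding outer_tri_def rhomb_def mem_Collect_eq
      by (elim conjE disjE; hypsubst; simp (no_asm_use) only: kf_coords; intro conjI; linarith)
    then show ?thesis ..
  next
    case 3
    then have False using e x y
      unfolding outer_tri_def rhomb_def mem_Collect_eq
      by (elim conjE disjE; hypsubst; simp (no_asm_use) only: kf_coords; linarith)
    then show ?thesis ..
  qed
  then show ?thesis by (auto simp: complex_eq_iff_sIm)
qed

text \<open>The corners of the initial triangle have angle pi / 3 as well, hence the same asymmetry;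
  here consecutive means cyclically consecutive.\<close>

lemma side_rhomb_touch:
  assumes ij: "i < 3" "j < 3" "i \<noteq> j" and x: "x \<in> rhomb" and y: "y \<in> outer_tri"
    and eq: "side i x = side j y"
  shows "x = 0 \<or> x = 1"
proof -
  have e: "Re (side i x) = Re (side j y)" "sIm (side i x) = sIm (side j y)" using eq by auto
  from ij consider
      "i = 0 \<and> j = Suc 0 \<or> i = Suc 0 \<and> j = 2 \<or> i = 2 \<and> j = 0"
    | "i = Suc 0 \<and> j = 0 \<or> i = 2 \<and> j = Suc 0 \<or> i = 0 \<and> j = 2"
    unfolding less_3_iff by (elim disjE) auto
  then have "Re x = 0 \<and> sIm x = 0 \<or> Re x = 1 \<and> sIm x = 0"
  proof cases
    case 1
    then have "Re x = 1 \<and> sIm x = 0" using e x y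
      unfolding outer_tri_def rhomb_def mem_Collect_eq
      by (elim conjE disjE; hypsubst; simp (no_asm_use) only: side_coords; intro conjI; linarith)
    then show ?thesis ..
  next
    case 2
    then have "Re x = 0 \<and> sIm x = 0" using e x y
      unfolding outer_tri_def rhomb_def mem_Collect_eq
      by (elim conjE disjE; hypsubst; simp (no_asm_use) only: side_coords; intro conjI; linarith)
    then show ?thesis ..
  qed
  then show ?thesis by (auto simp: complex_eq_iff_sIm)
qed

section \<open>The Koch curve as a limit set\<close>

primrec kmap :: "nat list \<Rightarrow> complex \<Rightarrow> complex" where
  "kmap [] = id"
| "kmap (i # w) = kf i \<circ> kmap w"

definition words :: "nat \<Rightarrow> nat list set" where
  "words k = {w \<in> lists {..<4}. length w = k}"

definition piece :: "nat \<Rightarrow> nat list \<Rightarrow> complex \<Rightarrow> complex" where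
  "piece j w = side j \<circ> kmap w"

text \<open>The closure of the vertices of all levels. Compactness and the endpoints come at once
  from this form; self-similarity is derived as \<open>koch_eq\<close>.\<close>

definition koch :: "complex set" where
  "koch = closure (\<Union>w\<in>lists {..<4}. {kmap w 0, kmap w 1})"

definition koch3 :: "complex set" where
  "koch3 = (\<Union>j<3. side j ` koch)"

lemma kmap_append: "kmap (v @ w) = kmap v \<circ> kmap w"
  by (induction v) (auto simp: fun_eq_iff)

lemma piece_snoc: "piece j (w @ [i]) z = piece j w (kf i z)"
  by (simp add: piece_def kmap_append)

lemma is_affine_kmap: "is_affine (kmap w)"
  by (induction w) (simp_all only: kmap.simps is_affine_comp is_affine_id is_affine_kf)

lemma is_affine_piece: "is_affine (piece j w)"
  unfolding piece_def by (intro is_affine_comp is_affine_kmap is_affine_side)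

lemma dist_kmap:
  assumes "w \<in> lists {..<4}"
  shows "dist (kmap w x) (kmap w y) = (1 / 3) ^ length w * dist x y"
  using assms by (induction w) (auto simp: dist_kf)

lemma dist_piece:
  assumes "w \<in> lists {..<4}" "j < 3"
  shows "dist (piece j w x) (piece j w y) = (1 / 3) ^ length w * dist x y"
  using assms by (simp add: piece_def dist_side dist_kmap)

lemma piece_ball:
  assumes "w \<in> lists {..<4}" "j < 3"
  shows "piece j w ` ball x e = ball (piece j w x) ((1 / 3) ^ length w * e)"
  using dist_piece[OF assms, of 0 1] by (intro affine_ball is_affine_piece) auto

lemma zero_one_outer_tri: "0 \<in> outer_tri" "1 \<in> outer_tri"
  by (auto simp: outer_tri_def rhomb_def)

lemma kmap_outer_tri: "w \<in> lists {..<4} \<Longrightarrow> z \<in> outer_tri \<Longrightarrow> kmap w z \<in> outer_tri"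
  by (induction w) (auto intro: kf_outer_tri)

lemma kmap_rhomb: "w \<in> lists {..<4} \<Longrightarrow> z \<in> rhomb \<Longrightarrow> kmap w z \<in> rhomb"
  by (induction w) (auto intro: kf_rhomb)

lemma kmap_orhomb: "w \<in> lists {..<4} \<Longrightarrow> z \<in> orhomb \<Longrightarrow> kmap w z \<in> orhomb"
  by (induction w) (auto intro: kf_orhomb)

lemma koch_subset: "koch \<subseteq> outer_tri"
  unfolding koch_def
  by (intro closure_minimal closed_outer_tri) (auto intro: kmap_outer_tri zero_one_outer_tri)

lemma compact_koch: "compact koch"
proof -
  have "bounded outer_tri"
    unfolding bounded_iff using norm_outer_tri by blast
  then show ?thesis
    using koch_subset bounded_subset unfolding koch_def compact_eq_bounded_closed by blast
qed

lemma zero_one_koch: "0 \<in> koch" "1 \<in> koch"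
proof -
  have "{kmap [] 0, kmap [] 1} \<subseteq> (\<Union>w\<in>lists {..<4}. {kmap w 0, kmap w 1})" by blast
  also have "\<dots> \<subseteq> koch" unfolding koch_def by (rule closure_subset)
  finally show "0 \<in> koch" "1 \<in> koch" by simp_all
qed

lemma closure_affine_image:
  assumes f: "is_affine f" and S: "bounded S"
  shows "closure (f ` S) = f ` closure S"
proof
  have "compact (f ` closure S)"
    using S by (intro compact_continuous_image is_affine_continuous f) (simp add: compact_closure)
  then show "closure (f ` S) \<subseteq> f ` closure S"
    by (intro closure_minimal image_mono closure_subset compact_imp_closed)
  show "f ` closure S \<subseteq> closure (f ` S)"
    by (rule image_closure_subset[OF is_affine_continuous[OF f] closed_closure closure_subset])
qed

lemma closure_finite_UN: "finite I \<Longrightarrow> closure (\<Union>i\<in>I. A i) = (\<Union>i\<in>I. closure (A i))"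
  by (induction I rule: finite_induct) auto

text \<open>The vertex set already solves the fixed-point equation, and closure commutes with finite
  unions and with affine images of bounded sets.\<close>

lemma koch_eq: "koch = (\<Union>i<4. kf i ` koch)"
proof -
  define V where "V = (\<Union>w\<in>lists {..<4}. {kmap w 0, kmap w 1})"
  have "V = (\<Union>i<4. kf i ` V)"
  proof
    show "V \<subseteq> (\<Union>i<4. kf i ` V)"
    proof
      fix z assume "z \<in> V"
      then obtain w t where w: "w \<in> lists {..<4}" "z = kmap w t" "t = 0 \<or> t = 1"
        unfolding V_def by blast
      have "\<exists>i<4. \<exists>v\<in>lists {..<4}. z = kf i (kmap v t)"
      proof (cases w)
        case Nil
        \<comment> \<open>The empty word has no first letter to split off, but 0 and 1 are the fixed
          points of the maps 0 and 3.\<close>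
        have "kf 0 0 = 0" "kf 3 1 = 1" by (simp_all add: kf_def)
        then have "z = kf 0 (kmap [] t) \<or> z = kf 3 (kmap [] t)" using Nil w(2,3) by auto
        moreover have "[] \<in> lists {..<4::nat}" "0 < (4::nat)" "3 < (4::nat)" by auto
        ultimately show ?thesis by blast
      next
        case (Cons i v)
        then show ?thesis using w by (intro exI[of _ i] conjI bexI[of _ v]) auto
      qed
      then obtain i v where v: "i < 4" "v \<in> lists {..<4}" "z = kf i (kmap v t)" by blast
      then have "kmap v t \<in> V" using w(3) unfolding V_def by blast
      then show "z \<in> (\<Union>i<4. kf i ` V)" using v by blast
    qed
    show "(\<Union>i<4. kf i ` V) \<subseteq> V"
    proof clarify
      fix i z assume i: "i < (4::nat)" "z \<in> V"
      then obtain w t where w: "w \<in> lists {..<4}" "z = kmap w t" "t = 0 \<or> t = 1"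
        unfolding V_def by blast
      then have "kf i z = kmap (i # w) t" "i # w \<in> lists {..<4}" using i by auto
      then show "kf i z \<in> V" unfolding V_def using w(3) by blast
    qed
  qed
  then have "closure V = closure (\<Union>i<4. kf i ` V)" by (rule arg_cong)
  also have "\<dots> = (\<Union>i<4. closure (kf i ` V))" by (rule closure_finite_UN) simp
  finally have "closure V = (\<Union>i<4. closure (kf i ` V))" .
  moreover have K: "koch = closure V" unfolding koch_def V_def ..
  moreover have "V \<subseteq> koch" unfolding K by (rule closure_subset)
  then have "bounded V" by (rule bounded_subset[OF compact_imp_bounded[OF compact_koch]])
  then have "closure (kf i ` V) = kf i ` koch" for i
    unfolding K by (rule closure_affine_image[OF is_affine_kf])
  ultimately show ?thesis using K by simp
qed

text \<open>A curve point of this image that comes from another piece is the image of an endpoint by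
  \<open>kf_rhomb_touch\<close>, and both endpoints belong to \<open>koch\<close>.\<close>

lemma kf_in_koch_iff:
  assumes "i < 4" "z \<in> rhomb"
  shows "kf i z \<in> koch \<longleftrightarrow> z \<in> koch"
proof
  assume "kf i z \<in> koch"
  then obtain j y where j: "j < 4" "y \<in> koch" "kf i z = kf j y" by (subst (asm) koch_eq) auto
  show "z \<in> koch"
  proof (cases "i = j")
    case True then show ?thesis using j kf_eq_iff by auto
  next
    case False
    then have "z = 0 \<or> z = 1" using kf_rhomb_touch[of i j z y] assms j koch_subset by blast
    then show ?thesis using zero_one_koch by auto
  qed
next
  assume "z \<in> koch"
  then have "kf i z \<in> (\<Union>i<4. kf i ` koch)" using assms by blast
  then show "kf i z \<in> koch" by (subst koch_eq)
qed

lemma kmap_in_koch_iff: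
  assumes "w \<in> lists {..<4}" "z \<in> rhomb"
  shows "kmap w z \<in> koch \<longleftrightarrow> z \<in> koch"
  using assms by (induction w) (auto simp: kf_in_koch_iff kmap_rhomb)

lemma piece_in_koch3_iff:
  assumes "w \<in> lists {..<4}" "j < 3" "z \<in> rhomb"
  shows "piece j w z \<in> koch3 \<longleftrightarrow> z \<in> koch"
proof
  assume "z \<in> koch"
  then have "kmap w z \<in> koch" using assms by (simp add: kmap_in_koch_iff)
  then show "piece j w z \<in> koch3"
    unfolding koch3_def piece_def using assms by auto
next
  assume "piece j w z \<in> koch3"
  then obtain i y where i: "i < 3" "y \<in> koch" "side j (kmap w z) = side i y"
    unfolding koch3_def piece_def by auto
  have "kmap w z \<in> koch"
  proof (cases "i = j")
    case True then show ?thesis using i side_eq_iff by auto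
  next
    case False
    then have "kmap w z = 0 \<or> kmap w z = 1"
      using side_rhomb_touch[of j i "kmap w z" y] assms i koch_subset kmap_rhomb by blast
    then show ?thesis using zero_one_koch by auto
  qed
  then show "z \<in> koch" using kmap_in_koch_iff assms by blast
qed

lemma koch_levels:
  assumes "x \<in> koch"
  shows "\<exists>w\<in>words k. \<exists>y\<in>koch. x = kmap w y"
proof (induction k)
  case 0
  then show ?case using assms by (auto simp: words_def)
next
  case (Suc k)
  then obtain w y where w: "w \<in> words k" "y \<in> koch" "x = kmap w y" by blast
  then obtain i z where "i < 4" "z \<in> koch" "y = kf i z" by (subst (asm) koch_eq) auto
  then have "x = kmap (w @ [i]) z" "w @ [i] \<in> words (Suc k)" "z \<in> koch"
    using w by (auto simp: words_def kmap_append)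
  then show ?case by blast
qed

lemma koch3_levels:
  assumes "x \<in> koch3"
  obtains j w y where "j < 3" "w \<in> words k" "y \<in> koch" "x = piece j w y"
proof -
  obtain j z where j: "j < 3" "z \<in> koch" "x = side j z" using assms unfolding koch3_def by auto
  obtain w y where "w \<in> words k" "y \<in> koch" "z = kmap w y" using koch_levels[OF j(2)] by blast
  then show thesis using that j by (simp add: piece_def)
qed

text \<open>The outer triangle lies in the unit disc around 0, so a piece of level \<open>k\<close>
  lies within 3^(- k) of its starting vertex.\<close>

lemma koch3_near:
  assumes "x \<in> koch3"
  obtains j w where "j < 3" "w \<in> words k" "dist x (piece j w 0) \<le> (1 / 3) ^ k"
proof -
  obtain j w y where j: "j < 3" "w \<in> words k" "y \<in> koch" "x = piece j w y"
    using koch3_levels[OF assms] by blast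
  then have "dist x (piece j w 0) = (1 / 3) ^ k * dist y 0"
    by (simp add: dist_piece words_def)
  also have "\<dots> \<le> (1 / 3) ^ k * 1"
    using j koch_subset norm_outer_tri by (intro mult_left_mono) auto
  finally show ?thesis using that j by auto
qed

lemma compact_koch3: "compact koch3"
  unfolding koch3_def
  by (intro compact_UN compact_continuous_image is_affine_continuous is_affine_side compact_koch) auto

lemma piece_0_in_koch3: "j < 3 \<Longrightarrow> w \<in> words k \<Longrightarrow> piece j w 0 \<in> koch3"
  using piece_in_koch3_iff zero_one_koch zero_one_outer_tri outer_tri_rhomb unfolding words_def by blast

section \<open>The approximating polygons and their limit\<close>

lemma words_Suc: "words (Suc k) = (\<Union>w\<in>words k. (\<lambda>i. w @ [i]) ` {..<4})"
proof (intro equalityI subsetI)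
  fix v assume "v \<in> words (Suc k)"
  then show "v \<in> (\<Union>w\<in>words k. (\<lambda>i. w @ [i]) ` {..<4})"
    by (cases v rule: rev_cases) (auto simp: words_def)
qed (auto simp: words_def)

lemma kf_endpoints:
  "kf 0 0 = 0" "kf 0 1 = 1/3" "kf 1 0 = 1/3" "kf 1 1 = 1/3 + cis (- pi / 3) / 3"
  "kf 2 0 = 1/3 + cis (- pi / 3) / 3" "kf 2 1 = 2/3" "kf 3 0 = 2/3" "kf 3 1 = 1"
proof -
  have "cis (pi / 3) = 1 - cis (- pi / 3)"
    by (simp add: complex_eq_iff_sIm cis_mult_coords del: cis.sel)
  then show "kf 2 1 = 2/3" by (simp add: kf_def diff_divide_distrib)
qed (simp_all add: kf_def)

text \<open>Refinement commutes with affine maps, so refining an edge amounts to appending one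
  letter to its word.\<close>

lemma set_koch_refine:
  assumes "is_affine f"
  shows "set (koch_refine (f 0, f 1)) = (\<lambda>i. (f (kf i 0), f (kf i 1))) ` {..<4}"
proof -
  obtain a b where f: "f = (\<lambda>z. a + b * z)" using assms by (rule is_affineE)
  have e: "koch_refine (f 0, f 1) = [(f 0, f (1/3)), (f (1/3), f (1/3 + cis (- pi / 3) / 3)),
      (f (1/3 + cis (- pi / 3) / 3), f (2/3)), (f (2/3), f 1)]"
    unfolding koch_refine_def Let_def f by (simp add: algebra_simps)
  have "{..<4} = {0, 1, 2, 3::nat}" by auto
  then show ?thesis unfolding e by (simp only: image_insert kf_endpoints image_empty list.set)
qed

lemma set_snowflake_polygon:
  "set (snowflake_polygon k) = (\<Union>j<3. (\<lambda>w. (piece j w 0, piece j w 1)) ` words k)"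
proof (induction k)
  case 0
  have "{..<3} = {0, 1, 2::nat}" "words 0 = {[]}" by (auto simp: words_def)
  then show ?case by (auto simp: snowflake_polygon_def piece_def side_def)
next
  case (Suc k)
  have "set (snowflake_polygon (Suc k)) = (\<Union>ab\<in>set (snowflake_polygon k). set (koch_refine ab))"
    by (simp add: snowflake_polygon_def koch_step_def)
  also have "\<dots> = (\<Union>j<3. \<Union>w\<in>words k. set (koch_refine (piece j w 0, piece j w 1)))"
    unfolding Suc by blast
  also have "\<dots> = (\<Union>j<3. \<Union>w\<in>words k. (\<lambda>i. (piece j (w @ [i]) 0, piece j (w @ [i]) 1)) ` {..<4})"
    by (simp only: set_koch_refine[OF is_affine_piece] piece_snoc)
  also have "\<dots> = (\<Union>j<3. (\<lambda>w. (piece j w 0, piece j w 1)) ` words (Suc k))"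
    unfolding words_Suc by blast
  finally show ?case .
qed

lemma closed_segment_outer_tri: "closed_segment 0 1 \<subseteq> outer_tri"
  using zero_one_outer_tri by (intro closed_segment_subset convex_outer_tri)

lemma tendsto_within_thirds:
  fixes X :: "nat \<Rightarrow> complex"
  assumes "\<And>k. dist (X k) (Y k) \<le> (1 / 3) ^ k"
  shows "(\<lambda>k. X k - Y k) \<longlonglongrightarrow> 0"
proof (rule tendsto_norm_zero_cancel, rule tendsto_sandwich[OF _ _ tendsto_const])
  show "\<forall>\<^sub>F k in sequentially. norm (X k - Y k) \<le> (1 / 3) ^ k"
    using assms by (simp add: dist_norm)
  show "(\<lambda>k. (1 / 3 :: real) ^ k) \<longlonglongrightarrow> 0" by (rule LIMSEQ_power_zero) simp
qed simp

text \<open>For each word, the edge and the curve piece both lie within 3^(- k) of the starting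
  vertex, which belongs to the polygon and to the curve. Points of one set can thus be exchanged for
  points of the other at vanishing distance.\<close>

lemma snowflake_curve_eq: "snowflake_curve = koch3"
proof (intro equalityI subsetI)
  fix x assume "x \<in> snowflake_curve"
  then obtain X where X: "\<And>k. X k \<in> polygon_set (snowflake_polygon k)" and lim: "X \<longlonglongrightarrow> x"
    unfolding snowflake_curve_def by blast
  have "\<exists>y. y \<in> koch3 \<and> dist y (X k) \<le> (1 / 3) ^ k" for k
  proof -
    obtain j w where w: "j < 3" "w \<in> words k" "X k \<in> closed_segment (piece j w 0) (piece j w 1)"
      using X[of k] unfolding polygon_set_def set_snowflake_polygon by auto
    then obtain t where t: "t \<in> closed_segment 0 1" "X k = piece j w t"
      unfolding is_affine_segment[OF is_affine_piece, symmetric] by blast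
    have "dist (piece j w 0) (X k) = (1 / 3) ^ k * dist 0 t"
      unfolding t(2) using w(1,2) unfolding words_def by (simp only: dist_piece mem_Collect_eq)
    also have "\<dots> \<le> (1 / 3) ^ k * 1"
      using norm_outer_tri t(1) closed_segment_outer_tri by (intro mult_left_mono) auto
    finally show ?thesis using piece_0_in_koch3[OF w(1,2)] by auto
  qed
  then obtain Y where Y: "\<And>k. Y k \<in> koch3" "\<And>k. dist (Y k) (X k) \<le> (1 / 3) ^ k" by metis
  have "Y \<longlonglongrightarrow> x"
    by (rule Lim_transform[OF lim tendsto_within_thirds[OF Y(2)]])
  then show "x \<in> koch3"
    by (rule closed_sequentially[OF compact_imp_closed[OF compact_koch3] Y(1)])
next
  fix x assume x: "x \<in> koch3"
  have "\<exists>y. y \<in> polygon_set (snowflake_polygon k) \<and> dist y x \<le> (1 / 3) ^ k" for k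
  proof -
    obtain j w where w: "j < 3" "w \<in> words k" "dist x (piece j w 0) \<le> (1 / 3) ^ k"
      using koch3_near[OF x] by blast
    have "piece j w 0 \<in> polygon_set (snowflake_polygon k)"
      unfolding polygon_set_def set_snowflake_polygon using w(1,2) by force
    then show ?thesis using w(3) by (metis dist_commute)
  qed
  then obtain X where X: "\<And>k. X k \<in> polygon_set (snowflake_polygon k)" "\<And>k. dist (X k) x \<le> (1 / 3) ^ k"
    by metis
  have "X \<longlonglongrightarrow> x"
    by (rule Lim_transform[OF tendsto_const tendsto_within_thirds[OF X(2)]])
  then show "x \<in> snowflake_curve" unfolding snowflake_curve_def using X(1) by blast
qed

section \<open>Points outside the snowflake curve\<close>

definition pt :: "real \<Rightarrow> real \<Rightarrow> complex" where
  "pt x v = Complex x (v / sqrt 3)"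

lemma pt_coords [simp]: "Re (pt x v) = x" "sIm (pt x v) = v"
  by (simp_all add: pt_def sIm_def)

lemma outside_connected:
  assumes "connected C" "C \<inter> S = {}" "x \<in> C" "y \<in> C" "x \<in> outside S"
  shows "y \<in> outside S"
  using connected_componentI[of C "- S" x y] outside_same_component[of S x y] assms by blast

lemma inside_connected:
  assumes "connected C" "C \<inter> S = {}" "x \<in> C" "y \<in> C" "x \<in> inside S"
  shows "y \<in> inside S"
  using connected_componentI[of C "- S" x y] inside_same_component[of S x y] assms by blast

lemma piece_segment_avoids:
  assumes "w \<in> lists {..<4}" "j < 3" "x \<in> rhomb" "y \<in> rhomb" "closed_segment x y \<inter> koch = {}"
  shows "piece j w ` closed_segment x y \<inter> koch3 = {}"
proof -
  have "closed_segment x y \<subseteq> rhomb"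
    using assms convex_rhomb by (intro closed_segment_subset)
  then show ?thesis using assms piece_in_koch3_iff[OF assms(1,2)] by blast
qed

lemma connected_piece_segment: "connected (piece j w ` closed_segment x y)"
  by (intro connected_continuous_image is_affine_continuous is_affine_piece connected_segment)

lemma piece_segment_outside:
  assumes "w \<in> lists {..<4}" "j < 3" "x \<in> rhomb" "y \<in> rhomb" "closed_segment x y \<inter> koch = {}"
    and "piece j w x \<in> outside koch3"
  shows "piece j w y \<in> outside koch3"
  by (rule outside_connected[OF connected_piece_segment piece_segment_avoids[OF assms(1-5)] _ _ assms(6)]) auto

lemma piece_segment_inside:
  assumes "w \<in> lists {..<4}" "j < 3" "x \<in> rhomb" "y \<in> rhomb" "closed_segment x y \<inter> koch = {}"
    and "piece j w x \<in> inside koch3"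
  shows "piece j w y \<in> inside koch3"
  by (rule inside_connected[OF connected_piece_segment piece_segment_avoids[OF assms(1-5)] _ _ assms(6)]) auto

lemma koch_cases:
  assumes "z \<in> koch"
  obtains y i where "y \<in> outer_tri" "i < 4" "z = kf i y"
  using assms koch_subset by (subst (asm) koch_eq) blast

text \<open>On the axis of symmetry the curve has no point above the tip of the bump; this leaves a
  passage from the inner half into the bump.\<close>

lemma koch_axis:
  assumes "z \<in> koch" "Re z = 1 / 2"
  shows "sIm z \<le> - 1 / 2"
proof -
  obtain y i where "y \<in> outer_tri" "i < 4" "z = kf i y" using koch_cases[OF assms(1)] .
  then show ?thesis using assms(2) unfolding outer_tri_def rhomb_def mem_Collect_eq less_4_iff
    by (elim conjE disjE; hypsubst; simp (no_asm_use) only: kf_coords; linarith)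
qed

text \<open>Left of Re = 1/3 only the image 0 of the outer triangle is present, and the bound is its
  right leg. Below that leg lies the gap between the first two children.\<close>

lemma koch_left_gap:
  assumes "z \<in> koch" "Re z < 1 / 3"
  shows "Re z - 1 / 3 \<le> sIm z"
proof -
  obtain y i where "y \<in> outer_tri" "i < 4" "z = kf i y" using koch_cases[OF assms(1)] .
  then show ?thesis using assms(2) unfolding outer_tri_def rhomb_def mem_Collect_eq less_4_iff
    by (elim conjE disjE; hypsubst; simp (no_asm_use) only: kf_coords; linarith)
qed

lemma koch_right_gap:
  assumes "z \<in> koch" "2 / 3 < Re z"
  shows "2 / 3 - Re z \<le> sIm z"
proof -
  obtain y i where "y \<in> outer_tri" "i < 4" "z = kf i y" using koch_cases[OF assms(1)] .
  then show ?thesis using assms(2) unfolding outer_tri_def rhomb_def mem_Collect_eq less_4_iff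
    by (elim conjE disjE; hypsubst; simp (no_asm_use) only: kf_coords; linarith)
qed

text \<open>The six lines carry the legs of the three outer triangles and bound a regular hexagon.
  The coefficients, zeros included, are spelled out to match
  \<open>halfplane_outside\<close>.\<close>

lemma hexagon:
  assumes "z \<in> koch3"
  shows "1 * Re z + 1 * sIm z \<ge> 0" "(-1) * Re z + 1 * sIm z \<ge> -1" "(-1) * Re z + 0 * sIm z \<ge> -1"
    "(-1) * Re z + (-1) * sIm z \<ge> -2" "1 * Re z + 0 * sIm z \<ge> 0" "1 * Re z + (-1) * sIm z \<ge> -1"
proof -
  obtain y i where y: "y \<in> outer_tri" "i < 3" "z = side i y"
    using assms koch_subset unfolding koch3_def by auto
  then have "0 \<le> Re z + sIm z \<and> Re z - sIm z \<le> 1 \<and> Re z \<le> 1 \<and> Re z + sIm z \<le> 2 \<and> 0 \<le> Re z \<and> sIm z \<le> 1 + Re z"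
    unfolding outer_tri_def rhomb_def mem_Collect_eq less_3_iff
    by (elim conjE disjE; hypsubst; simp (no_asm_use) only: side_coords; intro conjI; linarith)
  then show "1 * Re z + 1 * sIm z \<ge> 0" "(-1) * Re z + 1 * sIm z \<ge> -1" "(-1) * Re z + 0 * sIm z \<ge> -1"
    "(-1) * Re z + (-1) * sIm z \<ge> -2" "1 * Re z + 0 * sIm z \<ge> 0" "1 * Re z + (-1) * sIm z \<ge> -1"
    by auto
qed

text \<open>From a point on a supporting line but off the curve, moving by \<open>- pt a b\<close>
  strictly lowers the linear form, and everything beyond the line is outside.\<close>

lemma halfplane_outside:
  assumes H: "\<And>z. z \<in> koch3 \<Longrightarrow> a * Re z + b * sIm z \<ge> c"
    and ab: "a \<noteq> 0 \<or> b \<noteq> 0" and x: "a * Re x + b * sIm x = c" "x \<notin> koch3"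
  shows "x \<in> outside koch3"
proof -
  define y where "y = x - pt a b"
  have neg: "0 < a * a + b * b" using ab by (metis sum_squares_gt_zero_iff)
  define T where "T = {z. (-a) * Re z + (-b) * sIm z \<le> - c}"
  have "convex T" unfolding T_def by (rule convex_sIm_le)
  moreover have "koch3 \<subseteq> T" using H unfolding T_def by force
  ultimately have out: "- T \<subseteq> outside koch3" by (rule outside_subset_convex)
  have val: "a * Re z + b * sIm z = c - u * (a * a + b * b)" if "z = (1 - u) *\<^sub>R x + u *\<^sub>R y" for u z
    unfolding that y_def using x(1) by (simp add: algebra_simps)
  have "closed_segment x y \<inter> koch3 = {}"
  proof (rule ccontr)
    assume "closed_segment x y \<inter> koch3 \<noteq> {}"
    then obtain z u where z: "z \<in> koch3" "0 \<le> u" "z = (1 - u) *\<^sub>R x + u *\<^sub>R y"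
      unfolding closed_segment_def by auto
    then have "u * (a * a + b * b) \<le> 0" using H[OF z(1)] val[OF z(3)] by simp
    then have "u = 0" using z(2) neg by (metis mult_pos_pos not_less order_le_less)
    then show False using z x by simp
  qed
  moreover have "y \<in> - T" unfolding T_def using val[of y 1] neg by simp
  then have "y \<in> outside koch3" using out by blast
  ultimately show ?thesis
    using outside_connected[OF connected_segment(1), of y x koch3 y x] by (simp add: closed_segment_commute)
qed

lemma outer_edges_rhomb: "outer_edges \<subseteq> rhomb"
  by (auto simp: outer_edges_def)

lemma side_outer_edges:
  assumes "j < 3" "z \<in> outer_edges" "z \<notin> koch"
  shows "side j z \<in> outside koch3"
proof -
  have n: "side j z \<notin> koch3"
    using piece_in_koch3_iff[of "[]" j z] assms outer_edges_rhomb by (auto simp: piece_def)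
  consider "sIm z = - Re z" | "sIm z = Re z - 1" using assms(2) by (auto simp: outer_edges_def)
  then show ?thesis
  proof cases
    case 1
    consider "j = 0" | "j = Suc 0" | "j = 2" using assms(1) unfolding less_3_iff by blast
    then show ?thesis
    proof cases
      case a: 1 show ?thesis by (rule halfplane_outside[OF hexagon(1) _ _ n]) (simp_all add: a side_coords 1)
    next
      case a: 2 show ?thesis by (rule halfplane_outside[OF hexagon(3) _ _ n]) (simp_all add: a side_coords 1)
    next
      case a: 3 show ?thesis by (rule halfplane_outside[OF hexagon(6) _ _ n]) (simp_all add: a side_coords 1)
    qed
  next
    case 2
    consider "j = 0" | "j = Suc 0" | "j = 2" using assms(1) unfolding less_3_iff by blast
    then show ?thesis
    proof cases
      case a: 1 show ?thesis by (rule halfplane_outside[OF hexagon(2) _ _ n]) (simp_all add: a side_coords 2)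
    next
      case a: 2 show ?thesis by (rule halfplane_outside[OF hexagon(4) _ _ n]) (simp_all add: a side_coords 2, (simp add: field_simps)?)
    next
      case a: 3 show ?thesis by (rule halfplane_outside[OF hexagon(5) _ _ n]) (simp_all add: a side_coords 2, (simp add: field_simps)?)
    qed
  qed
qed

text \<open>\<open>x\<close> may lie on the rim of the gap, but \<open>y\<close> satisfies its
  inequalities strictly; so does every point of the segment except possibly \<open>x\<close>, and
  \<open>koch_left_gap\<close> excludes such points from the curve.\<close>

lemma gap_segment_left:
  assumes x: "x \<notin> koch" "Re x \<le> 1 / 3" "sIm x \<le> Re x - 1 / 3" and y: "Re y < 1 / 3" "sIm y < Re y - 1 / 3"
  shows "closed_segment x y \<inter> koch = {}"
proof (rule ccontr)
  assume "closed_segment x y \<inter> koch \<noteq> {}"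
  then obtain z u where z: "z \<in> koch" "0 \<le> u" "u \<le> 1" "z = (1 - u) *\<^sub>R x + u *\<^sub>R y"
    unfolding closed_segment_def by auto
  have "u \<noteq> 0" using z(1,4) x(1) by auto
  then have u: "0 < u" using z(2) by simp
  have e1: "1 / 3 - Re z = (1 - u) * (1 / 3 - Re x) + u * (1 / 3 - Re y)"
    unfolding z(4) by (simp add: field_simps)
  have e2: "Re z - 1 / 3 - sIm z = (1 - u) * (Re x - 1 / 3 - sIm x) + u * (Re y - 1 / 3 - sIm y)"
    unfolding z(4) by (simp add: field_simps)
  have "0 < 1 / 3 - Re z" unfolding e1 using x y u z(3) by (intro add_nonneg_pos mult_nonneg_nonneg mult_pos_pos) auto
  moreover have "0 < Re z - 1 / 3 - sIm z" unfolding e2 using x y u z(3) by (intro add_nonneg_pos mult_nonneg_nonneg mult_pos_pos) auto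
  ultimately show False using koch_left_gap[OF z(1)] by linarith
qed

lemma gap_segment_right:
  assumes x: "x \<notin> koch" "2 / 3 \<le> Re x" "sIm x \<le> 2 / 3 - Re x" and y: "2 / 3 < Re y" "sIm y < 2 / 3 - Re y"
  shows "closed_segment x y \<inter> koch = {}"
proof (rule ccontr)
  assume "closed_segment x y \<inter> koch \<noteq> {}"
  then obtain z u where z: "z \<in> koch" "0 \<le> u" "u \<le> 1" "z = (1 - u) *\<^sub>R x + u *\<^sub>R y"
    unfolding closed_segment_def by auto
  have "u \<noteq> 0" using z(1,4) x(1) by auto
  then have u: "0 < u" using z(2) by simp
  have e1: "Re z - 2 / 3 = (1 - u) * (Re x - 2 / 3) + u * (Re y - 2 / 3)"
    unfolding z(4) by (simp add: field_simps)
  have e2: "2 / 3 - Re z - sIm z = (1 - u) * (2 / 3 - Re x - sIm x) + u * (2 / 3 - Re y - sIm y)"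
    unfolding z(4) by (simp add: field_simps)
  have "0 < Re z - 2 / 3" unfolding e1 using x y u z(3) by (intro add_nonneg_pos mult_nonneg_nonneg mult_pos_pos) auto
  moreover have "0 < 2 / 3 - Re z - sIm z" unfolding e2 using x y u z(3) by (intro add_nonneg_pos mult_nonneg_nonneg mult_pos_pos) auto
  ultimately show False using koch_right_gap[OF z(1)] by linarith
qed

text \<open>The midpoints of the two legs of the outer triangle. They lie on the outer edges and
  strictly within the gap inequalities, and so link a child to its parent.\<close>

lemma gap_midpoints:
  "pt (1/4) (-1/4) \<in> outer_edges" "pt (1/4) (-1/4) \<notin> koch"
  "pt (3/4) (-1/4) \<in> outer_edges" "pt (3/4) (-1/4) \<notin> koch"
  using koch_left_gap[of "pt (1/4) (-1/4)"] koch_right_gap[of "pt (3/4) (-1/4)"]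
  by (auto simp: outer_edges_def rhomb_def)

text \<open>Of the eight legs of the children, four lie on the legs of the parent and four border
  one of the two gaps.\<close>

lemma kf_outer_edges:
  assumes "i < 4" "z \<in> outer_edges"
  shows "kf i z \<in> outer_edges \<or> Re (kf i z) \<le> 1 / 3 \<and> sIm (kf i z) \<le> Re (kf i z) - 1 / 3
      \<or> 2 / 3 \<le> Re (kf i z) \<and> sIm (kf i z) \<le> 2 / 3 - Re (kf i z)"
proof -
  have "sIm (kf i z) = - Re (kf i z) \<or> sIm (kf i z) = Re (kf i z) - 1
      \<or> Re (kf i z) \<le> 1 / 3 \<and> sIm (kf i z) \<le> Re (kf i z) - 1 / 3
      \<or> 2 / 3 \<le> Re (kf i z) \<and> sIm (kf i z) \<le> 2 / 3 - Re (kf i z)"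
    using assms unfolding outer_edges_def rhomb_def mem_Collect_eq less_4_iff
    by (elim conjE disjE; simp only: kf_coords; argo)
  moreover have "kf i z \<in> rhomb" using assms outer_edges_rhomb kf_rhomb by blast
  ultimately show ?thesis unfolding outer_edges_def by blast
qed

text \<open>Appending a letter passes to a child, whose legs lie on those of the parent or are
  joined across a gap to the midpoint of one. For the empty word the legs lie on the
  hexagon.\<close>

lemma piece_outer_edges:
  assumes "w \<in> lists {..<4}" "j < 3" "z \<in> outer_edges" "z \<notin> koch"
  shows "piece j w z \<in> outside koch3"
  using assms(1,3,4)
proof (induction w arbitrary: z rule: rev_induct)
  case Nil
  then show ?case using side_outer_edges[OF assms(2)] by (simp add: piece_def)
next
  case (snoc i w)
  then have i: "i < 4" and w: "w \<in> lists {..<4}" by auto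
  have r: "kf i z \<in> rhomb" and n: "kf i z \<notin> koch"
    using snoc.prems i outer_edges_rhomb kf_in_koch_iff kf_rhomb by auto
  note m = gap_midpoints
  from kf_outer_edges[OF i snoc.prems(2)] consider "kf i z \<in> outer_edges"
    | "Re (kf i z) \<le> 1 / 3 \<and> sIm (kf i z) \<le> Re (kf i z) - 1 / 3"
    | "2 / 3 \<le> Re (kf i z) \<and> sIm (kf i z) \<le> 2 / 3 - Re (kf i z)" by blast
  then have "piece j w (kf i z) \<in> outside koch3"
  proof cases
    case 1 then show ?thesis using snoc.IH w n by blast
  next
    case 2
    then have "closed_segment (kf i z) (pt (1/4) (-1/4)) \<inter> koch = {}"
      by (intro gap_segment_left n) auto
    then show ?thesis
      using piece_segment_outside[OF w assms(2), of "pt (1/4) (-1/4)" "kf i z"]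
        snoc.IH[OF w m(1,2)] r m(1) outer_edges_rhomb by (auto simp: closed_segment_commute)
  next
    case 3
    then have "closed_segment (kf i z) (pt (3/4) (-1/4)) \<inter> koch = {}"
      by (intro gap_segment_right n) auto
    then show ?thesis
      using piece_segment_outside[OF w assms(2), of "pt (3/4) (-1/4)" "kf i z"]
        snoc.IH[OF w m(3,4)] r m(3) outer_edges_rhomb by (auto simp: closed_segment_commute)
  qed
  then show ?case by (simp add: piece_snoc)
qed

lemma piece_left_gap_outside:
  assumes "w \<in> lists {..<4}" "j < 3" "z \<in> rhomb" "Re z < 1 / 3" "sIm z < Re z - 1 / 3"
  shows "piece j w z \<in> outside koch3"
proof -
  note m = gap_midpoints(1,2)
  have "z \<notin> koch" using koch_left_gap assms by fastforce
  then have "closed_segment (pt (1/4) (-1/4)) z \<inter> koch = {}"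
    using assms m by (intro gap_segment_left) auto
  then show ?thesis
    using piece_segment_outside[OF assms(1,2) _ assms(3)] piece_outer_edges[OF assms(1,2) m]
      m(1) outer_edges_rhomb by blast
qed

section \<open>Points inside the snowflake curve\<close>

text \<open>The centre of the initial triangle is also the apex of the inner half of the rhombus,
  and all three \<open>side\<close> maps fix it.\<close>

definition center :: complex where
  "center = pt (1 / 2) (1 / 2)"

lemma side_center: "j < 3 \<Longrightarrow> side j center = center"
  unfolding complex_eq_iff_sIm center_def less_3_iff by (elim disjE; simp add: side_coords)

lemma center_not_outer_tri: "center \<notin> outer_tri"
  by (auto simp: center_def rhomb_def outer_tri_def)

lemma center_not_side: "j < 3 \<Longrightarrow> center \<notin> side j ` outer_tri"
proof (rule notI)
  assume j: "j < 3" and "center \<in> side j ` outer_tri"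
  then obtain z where z: "z \<in> outer_tri" "center = side j z" by blast
  have "side j center = side j z" by (rule trans[OF side_center[OF j] z(2)])
  then have "center = z" by (rule iffD1[OF side_eq_iff[OF j]])
  then show False using center_not_outer_tri z(1) by (metis (full_types))
qed

lemma center_not_koch3: "center \<notin> koch3"
  using center_not_side koch_subset unfolding koch3_def by blast

section \<open>Polygonal loops around the centre\<close>

primrec kpath :: "nat \<Rightarrow> real \<Rightarrow> complex" where
  "kpath 0 = linepath 0 1"
| "kpath (Suc n) = (kf 0 \<circ> kpath n) +++ (kf 1 \<circ> kpath n) +++ (kf 2 \<circ> kpath n) +++ (kf 3 \<circ> kpath n)"

lemma kpath_ends: "pathstart (kpath n) = 0 \<and> pathfinish (kpath n) = 1"
proof (induction n)
  case (Suc n)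
  then show ?case
    by (simp add: pathstart_compose pathfinish_compose kf_endpoints del: One_nat_def)
qed (simp del: linepath_0)

lemma path_kpath: "path (kpath n)"
proof (induction n)
  case (Suc n)
  then have "path (kf i \<circ> kpath n)" for i
    by (intro path_continuous_image is_affine_continuous is_affine_kf)
  then show ?case
    using kpath_ends[of n]
    by (simp add: pathstart_compose pathfinish_compose kf_endpoints del: One_nat_def)
qed (simp del: linepath_0)

lemma path_image_kpath_Suc:
  "path_image (kpath (Suc n)) = (\<Union>i<4. kf i ` path_image (kpath n))"
proof -
  have "{..<4} = {0, 1, 2, 3::nat}" by auto
  then show ?thesis
    using kpath_ends[of n]
    by (simp add: pathstart_compose pathfinish_compose kf_endpoints path_image_join path_image_compose
       Un_assoc del: One_nat_def)
qed

lemma path_image_kpath: "path_image (kpath n) \<subseteq> outer_tri"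
proof (induction n)
  case 0
  then show ?case using closed_segment_outer_tri by (simp del: linepath_0)
next
  case (Suc n)
  then show ?case unfolding path_image_kpath_Suc using kf_outer_tri by blast
qed

lemma kpath_near_koch:
  assumes "x \<in> path_image (kpath n)"
  shows "\<exists>y\<in>koch. dist x y \<le> (1 / 3) ^ n"
  using assms
proof (induction n arbitrary: x)
  case 0
  then have "norm x \<le> 1" using norm_outer_tri path_image_kpath by blast
  then show ?case using zero_one_koch(1) by (intro bexI[of _ 0]) auto
next
  case (Suc n)
  then obtain i z where i: "i < 4" "z \<in> path_image (kpath n)" "x = kf i z"
    unfolding path_image_kpath_Suc by auto
  then obtain y where y: "y \<in> koch" "dist z y \<le> (1 / 3) ^ n" using Suc.IH by blast
  then have "kf i y \<in> koch" using i kf_in_koch_iff koch_subset outer_tri_rhomb by blast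
  moreover have "dist x (kf i y) \<le> (1 / 3) ^ Suc n" using i y by (simp add: dist_kf)
  ultimately show ?case by blast
qed

text \<open>One path followed by the reverse of the other is a loop in a convex set that misses
  \<open>z\<close>.\<close>

lemma winding_number_same_ends:
  assumes g: "path g" and h: "path h" and ends: "pathstart g = pathstart h" "pathfinish g = pathfinish h"
    and T: "convex T" "path_image g \<subseteq> T" "path_image h \<subseteq> T" "z \<notin> T"
  shows "winding_number g z = winding_number h z"
proof -
  have "winding_number (g +++ reversepath h) z = 0"
    using assms by (intro winding_number_zero_outside[OF _ T(1) _ T(4)])
      (auto simp: path_image_join)
  moreover have "winding_number (g +++ reversepath h) z = winding_number g z + winding_number (reversepath h) z"
    using assms by (intro winding_number_join) auto
  moreover have "winding_number (reversepath h) z = - winding_number h z"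
    using assms by (intro winding_number_reversepath) auto
  ultimately show ?thesis by simp
qed

definition kloop :: "nat \<Rightarrow> real \<Rightarrow> complex" where
  "kloop n = (side 0 \<circ> kpath n) +++ (side 1 \<circ> kpath n) +++ (side 2 \<circ> kpath n)"

lemma side_endpoints:
  "side 0 0 = 0" "side 0 1 = 1" "side 1 0 = 1" "side 1 1 = cis (pi / 3)"
  "side 2 0 = cis (pi / 3)" "side 2 1 = 0"
  by (simp_all add: side_def)

lemma path_side_kpath: "path (side j \<circ> kpath n)"
  by (intro path_continuous_image is_affine_continuous is_affine_side path_kpath)

lemma side_kpath_ends:
  "pathstart (side j \<circ> kpath n) = side j 0" "pathfinish (side j \<circ> kpath n) = side j 1"
  using kpath_ends[of n] by (simp_all add: pathstart_compose pathfinish_compose)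

lemma path_kloop: "path (kloop n)" "pathfinish (kloop n) = pathstart (kloop n)"
  unfolding kloop_def using path_side_kpath
  by (simp_all add: side_kpath_ends side_endpoints del: One_nat_def)

lemma path_image_kloop: "path_image (kloop n) = (\<Union>j<3. side j ` path_image (kpath n))"
proof -
  have "{..<3} = {0, 1, 2::nat}" by auto
  then show ?thesis
    unfolding kloop_def
    by (simp add: side_kpath_ends side_endpoints path_image_join path_image_compose Un_assoc del: One_nat_def)
qed

lemma kloop_near_koch3:
  assumes "x \<in> path_image (kloop n)"
  shows "\<exists>y\<in>koch3. dist x y \<le> (1 / 3) ^ n"
proof -
  obtain j z where j: "j < 3" "z \<in> path_image (kpath n)" "x = side j z"
    using assms unfolding path_image_kloop by auto
  then obtain y where "y \<in> koch" "dist z y \<le> (1 / 3) ^ n" using kpath_near_koch by blast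
  then show ?thesis using j unfolding koch3_def by (intro bexI[of _ "side j y"]) (auto simp: dist_side)
qed

lemma kloop_bounded: "path_image (kloop n) \<subseteq> cball 0 2"
proof
  fix x assume "x \<in> path_image (kloop n)"
  then obtain j z where j: "j < 3" "z \<in> path_image (kpath n)" "x = side j z"
    unfolding path_image_kloop by auto
  have "norm (side j 0) \<le> 1" using j(1) by (auto simp: less_3_iff side_def)
  moreover have "dist x (side j 0) \<le> 1"
    using j norm_outer_tri path_image_kpath by (auto simp: dist_side)
  ultimately show "x \<in> cball 0 2"
    using dist_triangle[of x 0 "side j 0"] by simp
qed

text \<open>On each side the polygon and the straight segment lie in one convex triangle that misses
  the centre, so the loop winds like the boundary of the initial triangle.\<close>

lemma winding_number_kloop: "winding_number (kloop n) center \<noteq> 0"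
proof -
  define L where "L j = linepath (side j 0) (side j 1)" for j
  have img: "path_image (L j) \<subseteq> side j ` outer_tri" for j
    unfolding L_def path_image_linepath is_affine_segment[OF is_affine_side, symmetric]
    using closed_segment_outer_tri by blast
  have img': "path_image (side j \<circ> kpath n) \<subseteq> side j ` outer_tri" for j
    unfolding path_image_compose using path_image_kpath by blast
  have eq: "winding_number (side j \<circ> kpath n) center = winding_number (L j) center" if "j < 3" for j
    using that
    by (intro winding_number_same_ends[where T = "side j ` outer_tri"] path_side_kpath img img'
         is_affine_convex is_affine_side convex_outer_tri center_not_side)
      (auto simp: L_def side_kpath_ends)
  have nin: "center \<notin> path_image (L j)" "center \<notin> path_image (side j \<circ> kpath n)" if "j < 3" for j
    using img img' center_not_side[OF that] by blast+
  have "winding_number (kloop n) center = winding_number (side 0 \<circ> kpath n) center +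
      (winding_number (side 1 \<circ> kpath n) center + winding_number (side 2 \<circ> kpath n) center)"
    unfolding kloop_def using nin path_side_kpath
    by (simp add: winding_number_join side_kpath_ends side_endpoints path_image_join del: One_nat_def)
  also have "\<dots> = winding_number (L 0) center + (winding_number (L 1) center + winding_number (L 2) center)"
    by (simp add: eq)
  also have "\<dots> = winding_number (L 0 +++ L 1 +++ L 2) center"
    using nin[of 0] nin[of 1] nin[of 2] unfolding L_def
    by (simp add: winding_number_join side_endpoints path_image_join del: One_nat_def)
  also have "L 0 +++ L 1 +++ L 2 = linepath 0 1 +++ linepath 1 (cis (pi / 3)) +++ linepath (cis (pi / 3)) 0"
    unfolding L_def side_endpoints ..
  also have "winding_number \<dots> center \<noteq> 0"
  proof -
    have nc: "\<not> collinear {0, 1, cis (pi / 3)}"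
      unfolding collinear_lemma by (auto simp: complex_eq_iff_sIm cis_mult_coords simp del: cis.sel)
    have "center = (1/3) *\<^sub>R 0 + (1/3) *\<^sub>R 1 + (1/3) *\<^sub>R cis (pi / 3)"
      unfolding complex_eq_iff_sIm by (simp add: center_def cis_mult_coords del: cis.sel)
    then have "center \<in> interior (convex hull {0, 1, cis (pi / 3)})"
      unfolding interior_convex_hull_3_minimal[OF nc DIM_complex] mem_Collect_eq
      by (intro exI[of _ "1/3"]) auto
    from winding_number_triangle[OF this] show ?thesis by (simp del: linepath_0)
  qed
  finally show ?thesis .
qed

text \<open>An escape path has positive distance from the compact curve and therefore misses a
  polygon of high level, although that polygon winds around the centre.\<close>

lemma center_inside: "center \<in> inside koch3"
proof (rule ccontr)
  assume "center \<notin> inside koch3"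
  then have unb: "\<not> bounded (connected_component_set (- koch3) center)"
    using center_not_koch3 unfolding inside_def by auto
  \<comment> \<open>All loops stay in \<open>cball 0 2\<close>, so a point of norm above 2 is
    outside each of them.\<close>
  then have "\<not> (\<forall>y\<in>connected_component_set (- koch3) center. norm y \<le> 2)"
    unfolding bounded_iff by blast
  then obtain y where y: "connected_component (- koch3) center y" "2 < norm y"
    by (auto simp: not_le)
  have op: "open (- koch3)" using compact_koch3 compact_imp_closed by auto
  have "path_component (- koch3) center y"
    using y(1) open_path_connected_component[OF op] by simp
  then obtain g where g: "path g" "path_image g \<subseteq> - koch3" "pathstart g = center" "pathfinish g = y"
    unfolding path_component_def by blast
  have "\<exists>d>0. \<forall>x\<in>path_image g. \<forall>y\<in>koch3. d \<le> dist x y"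
    using g compact_koch3 by (intro separate_compact_closed compact_path_image compact_imp_closed) auto
  then obtain d where d: "d > 0" "\<And>x y. x \<in> path_image g \<Longrightarrow> y \<in> koch3 \<Longrightarrow> d \<le> dist x y" by blast
  obtain n where n: "(1 / 3) ^ n < d" using real_arch_pow_inv[of d "1/3"] d(1) by auto
  have disj: "path_image g \<inter> path_image (kloop n) = {}"
    using kloop_near_koch3 d(2) n by force
  have "- cball 0 2 \<subseteq> outside (path_image (kloop n))"
    by (rule outside_subset_convex[OF convex_cball kloop_bounded])
  then have "y \<in> outside (path_image (kloop n))" using y(2) by auto
  then have "center \<in> outside (path_image (kloop n))"
    using outside_connected[OF connected_path_image[OF g(1)] disj] g by (metis pathfinish_in_path_image pathstart_in_path_image)
  then show False
    using winding_number_zero_in_outside[OF path_kloop] winding_number_kloop by blast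
qed

section \<open>Joining the inner halves to the centre\<close>

lemma convex_inner_tri: "convex inner_tri"
proof -
  have e: "inner_tri = rhomb \<inter> {z. inner (Complex 0 1) z > 0}"
    by (auto simp: inner_tri_def sIm_def inner_complex_def zero_less_mult_iff)
  show ?thesis unfolding e by (intro convex_Int convex_rhomb convex_halfspace_gt)
qed

lemma inner_tri_rhomb: "inner_tri \<subseteq> rhomb"
  by (auto simp: inner_tri_def)

lemma inner_tri_koch: "inner_tri \<inter> koch = {}"
  using koch_subset by (auto simp: inner_tri_def outer_tri_def)

lemma center_inner_tri: "center \<in> inner_tri"
  by (auto simp: center_def rhomb_def inner_tri_def)

lemma piece_inner_tri_from_center:
  assumes "w \<in> lists {..<4}" "j < 3" "piece j w center \<in> inside koch3" "z \<in> inner_tri"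
  shows "piece j w z \<in> inside koch3"
proof -
  have "closed_segment center z \<subseteq> inner_tri"
    using assms center_inner_tri by (intro closed_segment_subset convex_inner_tri)
  then have "closed_segment center z \<inter> koch = {}" using inner_tri_koch by blast
  then show ?thesis
    using piece_segment_inside[OF assms(1,2) _ _ _ assms(3)] assms(4) center_inner_tri inner_tri_rhomb by blast
qed

text \<open>The apexes of the children 0 and 3 lie in the inner half of the parent. The children 1
  and 2 share an apex below the base, reached through the opening left by the removed middle
  third.\<close>

lemma piece_inner_tri_inside:
  assumes "w \<in> lists {..<4}" "j < 3" "z \<in> inner_tri"
  shows "piece j w z \<in> inside koch3"
  using assms(1,3)
proof (induction w arbitrary: z rule: rev_induct)
  case Nil
  have "piece j [] center = center" using side_center[OF assms(2)] by (simp add: piece_def)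
  then show ?case using piece_inner_tri_from_center[of "[]" j z] assms(2) Nil center_inside by auto
next
  case (snoc i w)
  then have i: "i < 4" and w: "w \<in> lists {..<4}" by auto
  have "i = 0 \<or> i = 3 \<or> i = Suc 0 \<or> i = 2" using i by auto
  then consider "i = 0 \<or> i = 3" | "kf i center = pt (1/2) (-1/6)"
    unfolding complex_eq_iff_sIm center_def by (elim disjE) (auto simp: kf_coords)
  then have "piece j w (kf i center) \<in> inside koch3"
  proof cases
    case 1
    then have "kf i center \<in> inner_tri" by (auto simp: center_def inner_tri_def rhomb_def kf_coords)
    then show ?thesis using snoc.IH w by blast
  next
    case 2
    let ?x = "pt (1/2) (1/6)" and ?y = "pt (1/2) (-1/6)"
    have x: "?x \<in> inner_tri" and y: "?y \<in> rhomb" by (auto simp: inner_tri_def rhomb_def)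
    have "closed_segment ?x ?y \<inter> koch = {}"
    proof (rule ccontr)
      assume "closed_segment ?x ?y \<inter> koch \<noteq> {}"
      then obtain z u where z: "z \<in> koch" "0 \<le> u" "u \<le> 1" "z = (1 - u) *\<^sub>R ?x + u *\<^sub>R ?y"
        unfolding closed_segment_def by auto
      have "Re z = 1/2" unfolding z(4) by (simp add: field_simps)
      moreover have "sIm z \<ge> -1/6" unfolding z(4) using z(2,3) by (simp add: field_simps)
      ultimately show False using koch_axis[OF z(1)] by simp
    qed
    then show ?thesis
      using piece_segment_inside[OF w assms(2) _ y] snoc.IH[OF w x] x inner_tri_rhomb 2 by auto
  qed
  then have "piece j (w @ [i]) center \<in> inside koch3" by (simp add: piece_snoc)
  then show ?case using piece_inner_tri_from_center[of "w @ [i]" j z] snoc.prems assms(2) by blast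
qed

lemma snowflake_eq: "snowflake = inside koch3"
  by (simp add: snowflake_def snowflake_curve_eq)

section \<open>Divergence of the perimeter\<close>

text \<open>\<open>inpt\<close> lies above the base in the strip 1/3 < Re < 2/3, and
  \<open>outpt\<close> in the left gap. The radius 1/36 used below is forced at
  \<open>outpt\<close>: its slack in Re + sIm > 0 and in sIm < Re - 1/3 is 1/12, and by
  \<open>ball_coords\<close> a ball of radius e can use up 3 e.\<close>

definition inpt :: complex where "inpt = pt (1 / 2) (1 / 6)"
definition outpt :: complex where "outpt = pt (1 / 4) (- 1 / 6)"

lemma ball_coords:
  assumes "x \<in> ball c e"
  shows "\<bar>Re x - Re c\<bar> < e" "\<bar>sIm x - sIm c\<bar> < 2 * e"
  using assms abs_Re_le_cmod[of "x - c"] abs_sIm_le[of "x - c"]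
  by (auto simp: dist_norm norm_minus_commute)

lemma ball_inpt:
  assumes "x \<in> ball inpt (1 / 36)"
  shows "x \<in> inner_tri" "x \<in> orhomb" "1 / 3 < Re x" "Re x < 2 / 3"
  using ball_coords[OF assms] by (auto simp: inpt_def inner_tri_def rhomb_def orhomb_def abs_if split: if_splits)

lemma ball_outpt:
  assumes "x \<in> ball outpt (1 / 36)"
  shows "x \<in> rhomb" "Re x < 1 / 3" "sIm x < Re x - 1 / 3"
  using ball_coords[OF assms] by (auto simp: outpt_def rhomb_def abs_if split: if_splits)

text \<open>The children 0 and 3 stay off the strip 1/3 < Re < 2/3, and the children 1 and 2 do not
  rise above the base.\<close>

lemma kf_not_ball_inpt:
  assumes "i < 4" "y \<in> rhomb" "kf i y \<in> ball inpt (1 / 36)"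
  shows False
proof -
  have "1 / 3 < Re (kf i y)" "Re (kf i y) < 2 / 3" "0 < sIm (kf i y)"
    using ball_inpt[OF assms(3)] by (auto simp: inner_tri_def)
  then show False using assms(1,2) unfolding less_4_iff rhomb_def mem_Collect_eq
    by (elim conjE disjE; simp only: kf_coords; linarith)
qed

lemma orhomb_rhomb: "orhomb \<subseteq> rhomb"
  by (auto simp: orhomb_def rhomb_def)

text \<open>The words may differ in length. If they differ at some letter, the open rhombi separate
  them there; if one is a prefix of the other, \<open>kf_not_ball_inpt\<close> keeps the descendant
  out of the ball of its ancestor.\<close>

lemma kmap_ball_inpt_disjoint:
  assumes "v \<in> lists {..<4}" "w \<in> lists {..<4}" "v \<noteq> w"
    "x \<in> ball inpt (1 / 36)" "y \<in> ball inpt (1 / 36)"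
  shows "kmap v x \<noteq> kmap w y"
  using assms(1-3)
proof (induction v arbitrary: w)
  case Nil
  then obtain i u where w: "w = i # u" by (cases w) auto
  then have "kmap u y \<in> rhomb" "i < 4" using Nil ball_inpt(2)[OF assms(5)] kmap_rhomb orhomb_rhomb by auto
  then show ?case using kf_not_ball_inpt[of i "kmap u y"] assms(4) w by auto
next
  case (Cons i v)
  show ?case
  proof (cases w)
    case Nil
    have "kmap v x \<in> rhomb" "i < 4" using Cons ball_inpt(2)[OF assms(4)] kmap_rhomb orhomb_rhomb by auto
    then show ?thesis using kf_not_ball_inpt[of i "kmap v x"] assms(5) Nil by auto
  next
    case w: (Cons j u)
    have ij: "i < 4" "j < 4" and vu: "v \<in> lists {..<4}" "u \<in> lists {..<4}" using Cons w by auto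
    have o: "kmap v x \<in> orhomb" "kmap u y \<in> orhomb"
      using vu ball_inpt(2)[OF assms(4)] ball_inpt(2)[OF assms(5)] kmap_orhomb by auto
    show ?thesis
    proof (cases "i = j")
      case True
      then have "v \<noteq> u" using w Cons.prems by auto
      then have "kmap v x \<noteq> kmap u y" using Cons.IH vu by auto
      then show ?thesis using w True kf_eq_iff[OF ij(1)] by simp
    next
      case False
      then show ?thesis using kf_orhomb_disjoint[OF ij False o] w by simp
    qed
  qed
qed

lemma piece_ball_disjoint:
  assumes "v \<in> lists {..<4}" "w \<in> lists {..<4}" "v \<noteq> w"
  shows "piece 0 v ` ball inpt (1 / 36) \<inter> piece 0 w ` ball inpt (1 / 36) = {}"
  using kmap_ball_inpt_disjoint[OF assms] by (auto simp: piece_def side_def)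

lemma snowflake_ball:
  assumes "w \<in> lists {..<4}" "j < 3"
  shows "piece j w ` ball inpt (1 / 36) \<subseteq> snowflake"
  using piece_inner_tri_inside[OF assms] ball_inpt(1) unfolding snowflake_eq by blast

lemma snowflake_compl_ball:
  assumes "w \<in> lists {..<4}" "j < 3"
  shows "piece j w ` ball outpt (1 / 36) \<subseteq> - snowflake"
  using piece_left_gap_outside[OF assms] ball_outpt inside_Int_outside[of koch3] unfolding snowflake_eq by blast

lemma dist_ball_inpt_outpt:
  assumes "x \<in> ball inpt (1 / 36)" "y \<in> ball outpt (1 / 36)"
  shows "dist x y \<le> 1"
proof -
  have "(dist inpt outpt)\<^sup>2 \<le> (1 / 2)\<^sup>2"
    unfolding dist_norm norm_sIm by (simp add: inpt_def outpt_def power2_eq_square)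
  then have "dist inpt outpt \<le> 1 / 2" by (rule power2_le_imp_le) simp
  then show ?thesis
    using assms dist_triangle[of x y inpt] dist_triangle[of inpt y outpt] by (simp add: dist_commute)
qed

lemma finite_words: "finite (words k)"
  and card_words: "card (words k) = 4 ^ k"
proof -
  have "words k = {xs. set xs \<subseteq> {..<4} \<and> length xs = k}"
    by (auto simp: words_def)
  then show "finite (words k)" "card (words k) = 4 ^ k"
    using finite_lists_length_eq[of "{..<4::nat}" k] card_lists_length_eq[of "{..<4::nat}" k] by auto
qed

lemma words_lists: "w \<in> words k \<Longrightarrow> w \<in> lists {..<4}" and words_length: "w \<in> words k \<Longrightarrow> length w = k"
  by (auto simp: words_def)

lemma open_snowflake: "open snowflake"
  unfolding snowflake_eq by (intro open_inside compact_imp_closed compact_koch3)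

lemma bounded_snowflake: "bounded snowflake"
  unfolding snowflake_eq by (intro bounded_inside compact_imp_bounded compact_koch3)

lemma s_perimeter_eq: "s_perimeter s E = L_s s E (- E)"
  by (simp add: s_perimeter_def s_perimeter_in_def L_s_def)

lemma local_s_perimeter_UNIV: "local_s_perimeter s E UNIV = s_perimeter s E"
  by (simp add: s_perimeter_eq local_s_perimeter_def)

lemma emeasure_ball_complex:
  fixes c :: complex
  assumes "0 \<le> r"
  shows "emeasure lborel (ball c r) = ennreal (pi * r\<^sup>2)"
  using emeasure_ball[OF assms, of c] by (simp add: unit_ball_vol_2 eval_unit_ball_vol)

text \<open>The outer ball of the same piece lies within 3^(- k) of \<open>x\<close>, and the kernel
  decreases with the distance.\<close>

lemma snowflake_kernel_lower:
  fixes s :: real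
  assumes s: "0 < s" and w: "w \<in> words k" and x: "x \<in> piece 0 w ` ball inpt (1 / 36)"
  shows "ennreal (((1 / 3) ^ k) powr (- (2 + s)) * (pi * ((1 / 3) ^ k / 36)\<^sup>2))
     \<le> (\<integral>\<^sup>+ y. ennreal (dist x y powr (- (2 + s))) * indicator (- snowflake) y \<partial>lborel)"
proof -
  define r where "r = (1 / 3 :: real) ^ k"
  have r: "r > 0" by (simp add: r_def)
  note wl = words_lists[OF w] and len = words_length[OF w]
  define B where "B = piece 0 w ` ball outpt (1 / 36)"
  have B: "B = ball (piece 0 w outpt) (r / 36)"
    unfolding B_def using piece_ball[OF wl, of 0] by (simp add: len r_def)
  have sub: "B \<subseteq> - snowflake" unfolding B_def using snowflake_compl_ball[OF wl, of 0] by simp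
  have xS: "x \<in> snowflake" using snowflake_ball[OF wl, of 0] x by auto
  have "ennreal (r powr (- (2 + s)) * (pi * (r / 36)\<^sup>2)) = ennreal (r powr (- (2 + s))) * emeasure lborel B"
    unfolding B using r by (simp add: emeasure_ball_complex ennreal_mult)
  also have "\<dots> = (\<integral>\<^sup>+ y. ennreal (r powr (- (2 + s))) * indicator B y \<partial>lborel)"
    by (rule nn_integral_cmult_indicator[symmetric]) (simp add: B)
  also have "\<dots> \<le> (\<integral>\<^sup>+ y. ennreal (dist x y powr (- (2 + s))) * indicator (- snowflake) y \<partial>lborel)"
  proof (intro nn_integral_mono)
    fix y
    show "ennreal (r powr (- (2 + s))) * indicator B y
        \<le> ennreal (dist x y powr (- (2 + s))) * indicator (- snowflake) y"
    proof (cases "y \<in> B")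
      case True
      then obtain x' y' where xy: "x' \<in> ball inpt (1 / 36)" "y' \<in> ball outpt (1 / 36)"
        "x = piece 0 w x'" "y = piece 0 w y'" using x unfolding B_def by blast
      have "dist x y = r * dist x' y'"
        unfolding xy(3,4) using dist_piece[OF wl, of 0] by (simp add: r_def len)
      also have "\<dots> \<le> r * 1" using dist_ball_inpt_outpt[OF xy(1,2)] r by (intro mult_left_mono) auto
      finally have "dist x y \<le> r" by simp
      \<comment> \<open>At distance 0 the kernel would be 0, since \<open>0 powr a = 0\<close>, and
        the comparison would fail.\<close>
      moreover have "0 < dist x y" using xS True sub by auto
      ultimately have "r powr (- (2 + s)) \<le> dist x y powr (- (2 + s))"
        using s by (intro powr_mono2') auto
      then show ?thesis using True sub by (auto simp: ennreal_leI indicator_def)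
    qed simp
  qed
  finally show ?thesis unfolding r_def .
qed

text \<open>With r = 3^(- k), the kernel times two areas of order r^2 is r^(2 - s), and the
  hypothesis on \<open>s\<close> says 3^(2 - s) <= 4.\<close>

lemma powr_third_lower:
  fixes s :: real
  assumes "2 - ln 4 / ln 3 \<le> s"
  shows "(1 / 4) ^ k \<le> ((1 / 3) ^ k) powr (- (2 + s)) * (((1 / 3) ^ k)\<^sup>2)\<^sup>2"
proof -
  define r where "r = (1 / 3 :: real) ^ k"
  have r: "r > 0" by (simp add: r_def)
  have lr: "ln r = - (real k * ln 3)" by (simp add: r_def ln_realpow ln_div)
  have "(1 / 4) ^ k = exp (real k * (- ln 4))"
    by (simp add: exp_of_nat_mult exp_minus inverse_eq_divide power_one_over)
  also have "\<dots> \<le> exp ((2 - s) * ln r)"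
  proof -
    have "(2 - s) * ln 3 \<le> (ln 4 / ln 3) * ln 3" using assms by (intro mult_right_mono) auto
    then have "(2 - s) * ln 3 \<le> ln 4" by simp
    then have "real k * ((2 - s) * ln 3) \<le> real k * ln 4" by (intro mult_left_mono) auto
    then show ?thesis unfolding lr by (simp add: algebra_simps)
  qed
  also have "\<dots> = r powr (- (2 + s) + 4)" using r by (simp add: powr_def algebra_simps)
  also have "\<dots> = r powr (- (2 + s)) * r ^ 4" using r by (simp only: powr_add powr_numeral)
  also have "r ^ 4 = (r\<^sup>2)\<^sup>2" by (simp flip: power_mult)
  finally show ?thesis unfolding r_def .
qed

text \<open>At level \<open>k\<close> there are \<open>4^k\<close> disjoint balls, each contributing at least
  \<open>C * 3^(- (2 - s) * k) \<ge> C * 4^(- k)\<close>, so every level contributes at least \<open>C\<close>.\<close>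

lemma snowflake_perimeter_ge:
  fixes s :: real
  assumes s: "0 < s" "2 - ln 4 / ln 3 \<le> s"
  shows "ennreal (real n * (pi / 1296)\<^sup>2) \<le> s_perimeter s snowflake"
proof -
  define W where "W = (\<Union>k<n. words k)"
  define g where "g x = (\<integral>\<^sup>+ y. ennreal (dist x y powr (- (2 + s))) * indicator (- snowflake) y \<partial>lborel)" for x :: complex
  define c where "c w = ((1 / 3) ^ length w) powr (- (2 + s)) * (pi * ((1 / 3) ^ length w / 36)\<^sup>2)" for w :: "nat list"
  \<comment> \<open>The pieces of the first side alone already force divergence.\<close>
  define B where "B w = piece 0 w ` ball inpt (1 / 36)" for w
  have fW: "finite W" unfolding W_def using finite_words by auto
  have Wl: "w \<in> lists {..<4}" if "w \<in> W" for w using that words_lists unfolding W_def by auto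
  have B: "B w = ball (piece 0 w inpt) ((1 / 3) ^ length w / 36)" if "w \<in> W" for w
    unfolding B_def using piece_ball[OF Wl[OF that], of 0] by simp
  have le: "(\<Sum>w\<in>W. ennreal (c w) * indicator (B w) x) \<le> g x * indicator snowflake x" for x
  proof (cases "\<exists>w\<in>W. x \<in> B w")
    case True
    then obtain v where v: "v \<in> W" "x \<in> B v" by blast
    \<comment> \<open>The balls are disjoint, so the sum collapses to the term of
      \<open>v\<close>.\<close>
    have "indicator (B w) x = (0 :: ennreal)" if "w \<in> W - {v}" for w
      using piece_ball_disjoint[of v w] Wl v that unfolding B_def by (auto simp: indicator_def)
    then have "(\<Sum>w\<in>W. ennreal (c w) * indicator (B w) x) = ennreal (c v)"
      using v fW by (subst sum.remove[of _ v]) auto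
    also have "\<dots> \<le> g x"
      using v snowflake_kernel_lower[OF s(1), of v "length v" x] Wl unfolding c_def g_def B_def words_def by auto
    finally show ?thesis
      using v snowflake_ball[OF Wl[OF v(1)], of 0] unfolding B_def by (auto simp: indicator_def)
  next
    case False
    then show ?thesis by (simp add: indicator_def)
  qed
  \<comment> \<open>1296 = 36^2 comes from the area of a ball of radius r / 36; it is squared
    because an inner and an outer ball enter.\<close>
  have cB: "ennreal ((pi / 1296)\<^sup>2 * (1 / 4) ^ length w) \<le> ennreal (c w) * emeasure lborel (B w)" if "w \<in> W" for w
  proof -
    define r where "r = (1 / 3 :: real) ^ length w"
    have "(pi / 1296)\<^sup>2 * (1 / 4) ^ length w \<le> (pi / 1296)\<^sup>2 * (r powr (- (2 + s)) * (r\<^sup>2)\<^sup>2)"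
      unfolding r_def by (intro mult_left_mono powr_third_lower s) auto
    also have "\<dots> = c w * (pi * (r / 36)\<^sup>2)"
      unfolding c_def r_def[symmetric] by (simp add: power2_eq_square)
    finally show ?thesis
      unfolding B[OF that] r_def c_def by (simp add: emeasure_ball_complex ennreal_leI flip: ennreal_mult)
  qed
  have "ennreal (real n * (pi / 1296)\<^sup>2) = ennreal (\<Sum>w\<in>W. (pi / 1296)\<^sup>2 * (1 / 4) ^ length w)"
  proof -
    have "(\<Sum>w\<in>W. (pi / 1296)\<^sup>2 * (1 / 4) ^ length w) = (\<Sum>k<n. \<Sum>w\<in>words k. (pi / 1296)\<^sup>2 * (1 / 4) ^ length w)"
      unfolding W_def by (rule sum.UNION_disjoint) (auto simp: finite_words dest: words_length)
    also have "\<dots> = (\<Sum>k<n. \<Sum>w\<in>words k. (pi / 1296)\<^sup>2 * (1 / 4) ^ k)"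
      by (intro sum.cong refl) (simp add: words_length)
    also have "\<dots> = real n * (pi / 1296)\<^sup>2" by (simp add: card_words power_one_over)
    finally show ?thesis by simp
  qed
  also have "\<dots> = (\<Sum>w\<in>W. ennreal ((pi / 1296)\<^sup>2 * (1 / 4) ^ length w))" by (simp add: sum_ennreal)
  also have "\<dots> \<le> (\<Sum>w\<in>W. ennreal (c w) * emeasure lborel (B w))" by (intro sum_mono cB)
  also have "\<dots> = (\<Sum>w\<in>W. \<integral>\<^sup>+ x. ennreal (c w) * indicator (B w) x \<partial>lborel)"
    by (intro sum.cong refl nn_integral_cmult_indicator[symmetric]) (simp add: B)
  also have "\<dots> = (\<integral>\<^sup>+ x. (\<Sum>w\<in>W. ennreal (c w) * indicator (B w) x) \<partial>lborel)"
    by (rule nn_integral_sum[symmetric])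
      (intro borel_measurable_times_ennreal borel_measurable_const borel_measurable_indicator, simp add: B)
  also have "\<dots> \<le> (\<integral>\<^sup>+ x. g x * indicator snowflake x \<partial>lborel)"
    by (intro nn_integral_mono le)
  also have "\<dots> = s_perimeter s snowflake"
    unfolding s_perimeter_eq L_s_def g_def by simp
  finally show ?thesis .
qed

lemma snowflake_perimeter_infinite:
  fixes s :: real
  assumes s: "0 < s" "2 - ln 4 / ln 3 \<le> s"
  shows "s_perimeter s snowflake = \<infinity>"
proof (rule ccontr)
  assume "s_perimeter s snowflake \<noteq> \<infinity>"
  then obtain l where l: "0 \<le> l" "s_perimeter s snowflake = ennreal l" by (cases "s_perimeter s snowflake") auto
  obtain n where "l < real n * (pi / 1296)\<^sup>2"
    using reals_Archimedean3[of "(pi / 1296)\<^sup>2"] by (auto simp: zero_less_power)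
  moreover have "real n * (pi / 1296)\<^sup>2 \<le> l"
    using snowflake_perimeter_ge[OF s, of n] unfolding l(2) by (simp add: l(1))
  ultimately show False by simp
qed

section \<open>Convergence of the perimeter\<close>

text \<open>The radius allows 3^(- k) to reach the curve and another 3^(- k) to reach a vertex, so
  all points closer than 3^(- k) to the curve are included.\<close>

definition nbhd :: "nat \<Rightarrow> complex set" where
  "nbhd k = (\<Union>j<3. \<Union>w\<in>words k. ball (piece j w 0) (2 * (1 / 3) ^ k))"

lemma open_nbhd: "open (nbhd k)"
  unfolding nbhd_def by auto

lemma emeasure_nbhd: "emeasure lborel (nbhd k) \<le> ennreal (12 * pi * (4 / 9) ^ k)"
proof -
  let ?r = "2 * (1 / 3 :: real) ^ k"
  define I where "I = {..<3::nat} \<times> words k"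
  have "nbhd k = (\<Union>(j, w)\<in>I. ball (piece j w 0) ?r)"
    unfolding nbhd_def I_def by blast
  then have "emeasure lborel (nbhd k) \<le> (\<Sum>(j, w)\<in>I. emeasure lborel (ball (piece j w 0) ?r))"
    using emeasure_subadditive_finite[of I "\<lambda>(j, w). ball (piece j w 0) ?r" lborel]
    by (simp add: I_def finite_words case_prod_unfold image_subset_iff)
  also have "\<dots> = (\<Sum>(j, w)\<in>I. ennreal (pi * ?r\<^sup>2))"
    by (simp add: emeasure_ball_complex)
  also have "\<dots> = ennreal (\<Sum>i\<in>I. pi * ?r\<^sup>2)"
    by (subst sum_ennreal[symmetric]) (auto simp: case_prod_unfold)
  also have "(\<Sum>i\<in>I. pi * ?r\<^sup>2) = 3 * 4 ^ k * (pi * ?r\<^sup>2)"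
    by (simp add: I_def card_cartesian_product card_words)
  also have "3 * 4 ^ k * (pi * ?r\<^sup>2) = 12 * pi * (4 / 9) ^ k"
    by (simp add: power_mult_distrib power2_eq_square power_divide flip: power_mult_distrib)
  finally show ?thesis .
qed

lemma frontier_snowflake: "frontier snowflake \<subseteq> koch3"
  unfolding snowflake_eq by (intro frontier_inside_subset compact_imp_closed compact_koch3)

lemma snowflake_near_boundary:
  assumes "x \<in> snowflake" "y \<notin> snowflake" "dist x y < (1 / 3) ^ k"
  shows "x \<in> nbhd k"
proof -
  have "closed_segment x y \<inter> frontier snowflake \<noteq> {}"
    using assms by (intro connected_Int_frontier connected_segment) auto
  then obtain z where z: "z \<in> closed_segment x y" "z \<in> koch3" using frontier_snowflake by blast
  obtain j w where w: "j < 3" "w \<in> words k" "dist z (piece j w 0) \<le> (1 / 3) ^ k"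
    using koch3_near[OF z(2)] by blast
  have "dist x z \<le> dist x y" using z(1) dist_in_closed_segment[of z x y] by (simp add: dist_commute)
  then have "dist (piece j w 0) x < 2 * (1 / 3) ^ k"
    using w(3) assms(3) dist_triangle[of x "piece j w 0" z] by (simp add: dist_commute)
  then show ?thesis unfolding nbhd_def using w by auto
qed

lemma power_powr: "0 < x \<Longrightarrow> (x ^ k) powr a = (x powr a) ^ k" for x a :: real
  by (induction k) (auto simp: powr_mult)

text \<open>The scales are powers of 3, to match the pieces: 3^(- k - 1) <= d < 3^(- k) for small d,
  and 3^k <= d < 3^(k + 1) otherwise. The kernel is bounded by its value at the lower end.\<close>

lemma dyadic_kernel_bound:
  fixes d s :: real
  assumes d: "0 < d" and s: "0 < s"
  obtains k where "d < (1 / 3) ^ k" "d powr (- (2 + s)) \<le> (3 powr (2 + s)) ^ Suc k"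
    | k where "d < 3 ^ Suc k" "d powr (- (2 + s)) \<le> (3 powr (- (2 + s))) ^ k"
proof (cases "d < 1")
  case True
  obtain m where "(1 / 3) ^ m < d" using real_arch_pow_inv[of d "1/3"] d by auto
  \<comment> \<open>As \<open>d < 1\<close>, the exponent \<open>m\<close> is not 0 and hence a
    successor.\<close>
  then have ex: "\<exists>m. (1 / 3) ^ Suc m \<le> d" using True
    by (cases m) (auto intro: less_imp_le)
  define k where "k = (LEAST m. (1 / 3) ^ Suc m \<le> d)"
  have k: "(1 / 3) ^ Suc k \<le> d" unfolding k_def by (rule LeastI_ex[OF ex])
  have "d < (1 / 3) ^ k"
  proof (cases k)
    case (Suc l)
    then have "\<not> (1 / 3) ^ Suc l \<le> d" unfolding k_def by (intro not_less_Least) simp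
    then show ?thesis using Suc by simp
  qed (use True in simp)
  moreover have "d powr (- (2 + s)) \<le> ((1 / 3) ^ Suc k) powr (- (2 + s))"
    using s k by (intro powr_mono2') auto
  moreover have "((1 / 3) ^ Suc k) powr (- (2 + s)) = (3 powr (2 + s)) ^ Suc k"
  proof -
    have "(1 / 3 :: real) powr (- (2 + s)) = 3 powr (2 + s)" by (simp add: powr_def ln_div algebra_simps)
    then show ?thesis by (subst power_powr) auto
  qed
  ultimately show thesis using that(1) by metis
next
  case False
  obtain m where "d < 3 ^ m" using real_arch_pow[of 3 d] by auto
  moreover have "(3 :: real) ^ m \<le> 3 ^ Suc m" by simp
  ultimately have ex: "\<exists>m. d < 3 ^ Suc m" using less_le_trans by blast
  define k where "k = (LEAST m. d < 3 ^ Suc m)"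
  have k: "d < 3 ^ Suc k" unfolding k_def by (rule LeastI_ex[OF ex])
  have "3 ^ k \<le> d"
  proof (cases k)
    case (Suc l)
    then have "\<not> d < 3 ^ Suc l" unfolding k_def by (intro not_less_Least) simp
    then show ?thesis using Suc by simp
  qed (use False in simp)
  then have "d powr (- (2 + s)) \<le> (3 ^ k) powr (- (2 + s))"
    using s by (intro powr_mono2') auto
  also have "(3 ^ k) powr (- (2 + s)) = (3 powr (- (2 + s))) ^ k" by (rule power_powr) simp
  finally show thesis using that(2) k by metis
qed

lemma term_le_suminf_ennreal: "f k \<le> (\<Sum>k. f k)" for f :: "nat \<Rightarrow> ennreal"
  using sum_le_suminf[OF summableI, of "{k}" f] by simp

lemma suminf_ennreal_geometric_finite:
  assumes "0 \<le> c" "0 \<le> q" "q < 1"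
  shows "(\<Sum>k. ennreal (c * q ^ k)) < \<infinity>"
proof -
  have "summable (\<lambda>k. c * q ^ k)" using assms by (intro summable_mult summable_geometric) auto
  then have "(\<Sum>k. ennreal (c * q ^ k)) = ennreal (\<Sum>k. c * q ^ k)"
    using assms by (intro suminf_ennreal2) auto
  then show ?thesis by simp
qed

lemma snowflake_perimeter_finite:
  fixes s :: real
  assumes s: "0 < s" "s < 2 - ln 4 / ln 3"
  shows "s_perimeter s snowflake < \<infinity>"
proof -
  define t where "t = 3 powr (2 + s)"
  define u where "u = 3 powr (- (2 + s))"
  have t0: "t > 0" and u0: "u > 0" by (simp_all add: t_def u_def)
  \<comment> \<open>Near pairs: \<open>x\<close> is confined to the thin set \<open>nbhd k\<close>,
    \<open>y\<close> only to a ball around \<open>x\<close>.\<close>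
  define f where "f k x y = ennreal (t ^ Suc k) * indicator (nbhd k) x * indicator (ball x ((1 / 3) ^ k)) y"
    for k and x y :: complex
  \<comment> \<open>Far pairs: only the distance is used, and \<open>x\<close> will range over the
    bounded snowflake.\<close>
  define g where "g k x y = ennreal (u ^ k) * indicator (ball x (3 ^ Suc k)) y"
    for k and x y :: complex
  have le: "ennreal (dist x y powr (- (2 + s))) * indicator (- snowflake) y \<le> (\<Sum>k. f k x y) + (\<Sum>k. g k x y)"
    if x: "x \<in> snowflake" for x y
  proof (cases "y \<in> snowflake")
    case False
    then have d: "0 < dist x y" using x by auto
    have "ennreal (dist x y powr (- (2 + s))) \<le> (\<Sum>k. f k x y) + (\<Sum>k. g k x y)"
    proof (rule dyadic_kernel_bound[OF d s(1)])
      fix k assume k: "dist x y < (1 / 3) ^ k" "dist x y powr (- (2 + s)) \<le> (3 powr (2 + s)) ^ Suc k"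
      then have "ennreal (dist x y powr (- (2 + s))) \<le> f k x y"
        unfolding f_def t_def using snowflake_near_boundary[OF x False k(1)] by (simp add: ennreal_leI)
      also have "\<dots> \<le> (\<Sum>k. f k x y)" by (rule term_le_suminf_ennreal)
      finally show ?thesis by (simp add: add_increasing2)
    next
      fix k assume k: "dist x y < 3 ^ Suc k" "dist x y powr (- (2 + s)) \<le> (3 powr (- (2 + s))) ^ k"
      then have "ennreal (dist x y powr (- (2 + s))) \<le> g k x y"
        unfolding g_def u_def by (simp add: ennreal_leI)
      also have "\<dots> \<le> (\<Sum>k. g k x y)" by (rule term_le_suminf_ennreal)
      finally show ?thesis by (simp add: add_increasing)
    qed
    then show ?thesis using False by simp
  qed simp
  define p where "p k = t ^ Suc k * (pi * ((1 / 3) ^ k)\<^sup>2)" for k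
  define q where "q k = u ^ k * (pi * (3 ^ Suc k)\<^sup>2)" for k
  have p0: "p k \<ge> 0" and q0: "q k \<ge> 0" for k using t0 u0 by (auto simp: p_def q_def)
  have intf: "(\<integral>\<^sup>+ y. f k x y \<partial>lborel) = ennreal (p k) * indicator (nbhd k) x" for k x
    unfolding f_def p_def using t0
    by (subst nn_integral_cmult_indicator) (simp_all add: emeasure_ball_complex ennreal_mult mult_ac)
  have intg: "(\<integral>\<^sup>+ y. g k x y \<partial>lborel) = ennreal (q k)" for k x
    unfolding g_def q_def using u0
    by (subst nn_integral_cmult_indicator) (simp_all add: emeasure_ball_complex ennreal_mult)
  have mf: "f k x \<in> borel_measurable borel" and mg: "g k x \<in> borel_measurable borel" for k x
    unfolding f_def[abs_def] g_def[abs_def]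
    by (intro borel_measurable_times_ennreal borel_measurable_const borel_measurable_indicator; simp)+
  have inner: "(\<integral>\<^sup>+ y. ennreal (dist x y powr (- (2 + s))) * indicator (- snowflake) y \<partial>lborel)
      \<le> (\<Sum>k. ennreal (p k) * indicator (nbhd k) x) + (\<Sum>k. ennreal (q k))" if "x \<in> snowflake" for x
  proof -
    have "(\<integral>\<^sup>+ y. ennreal (dist x y powr (- (2 + s))) * indicator (- snowflake) y \<partial>lborel)
      \<le> (\<integral>\<^sup>+ y. (\<Sum>k. f k x y) + (\<Sum>k. g k x y) \<partial>lborel)"
      by (intro nn_integral_mono le that)
    also have "\<dots> = (\<integral>\<^sup>+ y. (\<Sum>k. f k x y) \<partial>lborel) + (\<integral>\<^sup>+ y. (\<Sum>k. g k x y) \<partial>lborel)"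
      by (rule nn_integral_add) (intro borel_measurable_suminf_order, simp add: mf mg)+
    also have "(\<integral>\<^sup>+ y. (\<Sum>k. f k x y) \<partial>lborel) = (\<Sum>k. \<integral>\<^sup>+ y. f k x y \<partial>lborel)"
      by (rule nn_integral_suminf) (simp add: mf)
    also have "(\<integral>\<^sup>+ y. (\<Sum>k. g k x y) \<partial>lborel) = (\<Sum>k. \<integral>\<^sup>+ y. g k x y \<partial>lborel)"
      by (rule nn_integral_suminf) (simp add: mg)
    finally show ?thesis unfolding intf intg .
  qed
  have [measurable]: "nbhd k \<in> sets borel" for k using open_nbhd by auto
  have [measurable]: "snowflake \<in> sets borel" using open_snowflake by auto
  \<comment> \<open>The near sum may be integrated over the whole plane; the far sum does not depend
    on \<open>x\<close> and must keep the indicator.\<close>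
  have "s_perimeter s snowflake
      \<le> (\<integral>\<^sup>+ x. (\<Sum>k. ennreal (p k) * indicator (nbhd k) x) + (\<Sum>k. ennreal (q k)) * indicator snowflake x \<partial>lborel)"
    unfolding s_perimeter_eq L_s_def
  proof (intro nn_integral_mono)
    fix x
    show "(\<integral>\<^sup>+ y. ennreal (dist x y powr - (real DIM(complex) + s)) * indicator (- snowflake) y \<partial>lborel) * indicator snowflake x
        \<le> (\<Sum>k. ennreal (p k) * indicator (nbhd k) x) + (\<Sum>k. ennreal (q k)) * indicator snowflake x"
      using inner[of x] by (cases "x \<in> snowflake") simp_all
  qed
  also have "\<dots> = (\<integral>\<^sup>+ x. (\<Sum>k. ennreal (p k) * indicator (nbhd k) x) \<partial>lborel)
      + (\<integral>\<^sup>+ x. (\<Sum>k. ennreal (q k)) * indicator snowflake x \<partial>lborel)"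
    by (rule nn_integral_add) simp_all
  also have "(\<integral>\<^sup>+ x. (\<Sum>k. ennreal (p k) * indicator (nbhd k) x) \<partial>lborel)
      = (\<Sum>k. \<integral>\<^sup>+ x. ennreal (p k) * indicator (nbhd k) x \<partial>lborel)"
    by (rule nn_integral_suminf) simp
  also have "\<dots> = (\<Sum>k. ennreal (p k) * emeasure lborel (nbhd k))"
    by (simp add: nn_integral_cmult_indicator)
  also have "(\<integral>\<^sup>+ x. (\<Sum>k. ennreal (q k)) * indicator snowflake x \<partial>lborel)
      = (\<Sum>k. ennreal (q k)) * emeasure lborel snowflake"
    by (simp add: nn_integral_cmult_indicator)
  also have "(\<Sum>k. ennreal (p k) * emeasure lborel (nbhd k)) + (\<Sum>k. ennreal (q k)) * emeasure lborel snowflake < \<infinity>"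
  proof -
    \<comment> \<open>The hypothesis on \<open>s\<close> in exponential form. With t = 3^(2 + s) it
      gives 4 t / 81 < 1, the ratio of the near series: t from the kernel, 1/9 from the ball, 4/9
      from \<open>nbhd k\<close>.\<close>
    have "3 powr (2 - s) > (4 :: real)"
    proof -
      have "ln 4 / ln 3 * ln 3 < (2 - s) * ln 3" using s by (intro mult_strict_right_mono) auto
      then have "ln 4 < ln (3 powr (2 - s))" by (simp add: ln_powr)
      then show ?thesis by (subst (asm) ln_less_cancel_iff) auto
    qed
    then have "t * 4 < t * 3 powr (2 - s)" using t0 by (intro mult_strict_left_mono)
    also have "\<dots> = 3 powr 4" unfolding t_def by (subst powr_add[symmetric]) simp
    finally have t1: "t * 4 / 81 < 1" by simp
    \<comment> \<open>The far series: per scale the area grows by 9 and the kernel bound shrinks by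
      3^(2 + s), so \<open>0 < s\<close> makes it converge.\<close>
    have "u * 9 = 3 powr (- s)"
    proof -
      have "u * 3 powr 2 = 3 powr (- s)" unfolding u_def by (simp only: powr_add[symmetric]) simp
      then show ?thesis by simp
    qed
    also have "\<dots> < 3 powr 0" using s(1) by (intro powr_less_mono) auto
    finally have u1: "u * 9 < 1" by simp
    have sq: "(a ^ k)\<^sup>2 = (a\<^sup>2) ^ k" for a :: real and k
      by (simp add: power_mult[symmetric] mult.commute)
    have "(\<Sum>k. ennreal (p k) * emeasure lborel (nbhd k)) \<le> (\<Sum>k. ennreal (12 * pi\<^sup>2 * t * (t * 4 / 81) ^ k))"
    proof (intro suminf_le summableI)
      fix k
      have "ennreal (p k) * emeasure lborel (nbhd k) \<le> ennreal (p k) * ennreal (12 * pi * (4 / 9) ^ k)"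
        by (intro mult_left_mono emeasure_nbhd) simp
      also have "\<dots> = ennreal (p k * (12 * pi * (4 / 9) ^ k))" using p0 by (simp add: ennreal_mult)
      also have "p k * (12 * pi * (4 / 9) ^ k) = 12 * pi\<^sup>2 * t * (t ^ k * ((1 / 9) ^ k * (4 / 9) ^ k))"
        unfolding p_def sq power_one_over[of 3 2] by (simp only: power2_eq_square power_Suc mult_ac) simp
      also have "t ^ k * ((1 / 9) ^ k * (4 / 9) ^ k) = (t * 4 / 81) ^ k"
        unfolding power_mult_distrib[symmetric] by simp
      finally show "ennreal (p k) * emeasure lborel (nbhd k) \<le> ennreal (12 * pi\<^sup>2 * t * (t * 4 / 81) ^ k)" .
    qed
    also have "\<dots> < \<infinity>" using t0 t1 by (intro suminf_ennreal_geometric_finite) auto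
    finally have 1: "(\<Sum>k. ennreal (p k) * emeasure lborel (nbhd k)) < \<infinity>" .
    have "q k = 9 * pi * (u * 9) ^ k" for k
    proof -
      have n: "((3 :: real) ^ Suc k)\<^sup>2 = 9 * 9 ^ k" unfolding sq by simp
      show ?thesis unfolding q_def n power_mult_distrib by simp
    qed
    then have q: "q = (\<lambda>k. 9 * pi * (u * 9) ^ k)" by (rule ext)
    have 2: "(\<Sum>k. ennreal (q k)) < \<infinity>"
      unfolding q using u0 u1 by (intro suminf_ennreal_geometric_finite) auto
    have 3: "emeasure lborel snowflake < \<infinity>"
      using emeasure_bounded_finite[OF bounded_snowflake] by simp
    have fin: "a < \<infinity> \<Longrightarrow> b < \<infinity> \<Longrightarrow> c < \<infinity> \<Longrightarrow> a + b * c < \<infinity>" for a b c :: ennreal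
      by (simp add: ennreal_mult_less_top)
    show ?thesis by (rule fin[OF 1 2 3])
  qed
  finally show ?thesis .
qed

section \<open>Box dimension\<close>

lemma ball_fmeasurable: "ball (x :: complex) r \<in> fmeasurable lborel"
  using emeasure_bounded_finite[OF bounded_ball] by (intro fmeasurableI) auto

lemma ball_measure_pos: "0 < r \<Longrightarrow> 0 < measure lborel (ball (x :: complex) r)"
  by (rule content_ball_pos)

text \<open>At every scale the piece around a curve point contains an inner and an outer ball, both
  of positive measure.\<close>

lemma measure_boundary_snowflake:
  assumes x: "x \<in> koch3"
  shows "x \<in> measure_boundary snowflake"
  unfolding measure_boundary_def
proof (intro CollectI allI impI)
  fix r :: real assume r: "r > 0"
  \<comment> \<open>Points of the unit rhombus are at most 2 apart, so the rhombus of a piece of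
    this level fits into the ball.\<close>
  obtain k where k: "(1 / 3 :: real) ^ k < r / 2" using real_arch_pow_inv[of "r / 2" "1/3"] r by auto
  obtain j w y where w: "j < 3" "w \<in> words k" "y \<in> koch" "x = piece j w y"
    using koch3_levels[OF x] by blast
  note wl = words_lists[OF w(2)] and len = words_length[OF w(2)]
  have near: "piece j w a \<in> ball x r" if a: "a \<in> rhomb" for a
  proof -
    have "norm y \<le> 1" using w(3) koch_subset norm_outer_tri by blast
    then have "dist y a \<le> 2" using norm_rhomb[OF a] norm_triangle_ineq4[of y a] by (simp add: dist_norm)
    have "dist x (piece j w a) = (1 / 3) ^ k * dist y a"
      unfolding w(4) by (simp add: dist_piece[OF wl w(1)] len)
    also have "\<dots> \<le> (1 / 3) ^ k * 2" using \<open>dist y a \<le> 2\<close> by (intro mult_left_mono) auto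
    finally show ?thesis using k by simp
  qed
  define e where "e = (1 / 3 :: real) ^ k / 36"
  have e: "e > 0" by (simp add: e_def)
  define A where "A = ball (piece j w inpt) e"
  define B where "B = ball (piece j w outpt) e"
  have A: "A = piece j w ` ball inpt (1 / 36)" and B: "B = piece j w ` ball outpt (1 / 36)"
    unfolding A_def B_def e_def using piece_ball[OF wl w(1)] len by auto
  have subA: "A \<subseteq> snowflake \<inter> ball x r"
    using snowflake_ball[OF wl w(1)] near ball_inpt(2) orhomb_rhomb unfolding A by blast
  have subB: "B \<subseteq> ball x r" "snowflake \<inter> B = {}"
    using snowflake_compl_ball[OF wl w(1)] near ball_outpt(1) unfolding B by blast+
  have "snowflake \<in> fmeasurable lborel"
    using open_snowflake emeasure_bounded_finite[OF bounded_snowflake] by (intro fmeasurableI) auto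
  then have meas: "snowflake \<inter> ball x r \<in> fmeasurable lborel"
    by (rule fmeasurable_Int_fmeasurable) simp
  have "0 < measure lborel A" unfolding A_def using e by (rule ball_measure_pos)
  also have "\<dots> \<le> measure lborel (snowflake \<inter> ball x r)"
    by (intro measure_mono_fmeasurable subA meas) (simp add: A_def)
  finally have 1: "0 < measure lborel (snowflake \<inter> ball x r)" .
  have "measure lborel (snowflake \<inter> ball x r) + measure lborel B = measure lborel (snowflake \<inter> ball x r \<union> B)"
    using subB(2) fmeasurableD2[OF meas] fmeasurableD2[OF ball_fmeasurable, of "piece j w outpt" e] open_snowflake
    by (intro measure_Union[symmetric]) (auto simp: B_def)
  also have "\<dots> \<le> measure lborel (ball x r)"
    using subB(1) open_snowflake by (intro measure_mono_fmeasurable ball_fmeasurable) (auto simp: B_def)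
  finally have "measure lborel (snowflake \<inter> ball x r) + measure lborel B \<le> measure lborel (ball x r)" .
  moreover have "0 < measure lborel B" unfolding B_def using e by (rule ball_measure_pos)
  ultimately show "0 < measure lborel (snowflake \<inter> ball x r) \<and>
      measure lborel (snowflake \<inter> ball x r) < measure lborel (ball x r)"
    using 1 by simp
qed

section \<open>Bounds for the covering number\<close>

lemma covering_number_le:
  assumes "finite C" "S \<subseteq> (\<Union>c\<in>C. ball c d)"
  shows "covering_number S d \<le> card C"
  unfolding covering_number_def using assms by (intro cInf_lower) auto

text \<open>Compactness makes the infimum range over a nonempty set.\<close>

lemma covering_number_ge:
  assumes "compact S" "0 < d" and "\<And>C. finite C \<Longrightarrow> S \<subseteq> (\<Union>c\<in>C. ball c d) \<Longrightarrow> n \<le> card C"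
  shows "n \<le> covering_number S d"
proof -
  obtain C where "finite C" "S \<subseteq> (\<Union>c\<in>C. ball c d)"
    using assms(1,2) unfolding compact_eq_totally_bounded by blast
  then show ?thesis unfolding covering_number_def using assms(3) by (intro cInf_greatest) auto
qed

lemma compact_frontier_snowflake: "compact (frontier snowflake)"
  by (intro compact_frontier_bounded bounded_snowflake)

lemma covering_number_snowflake_le:
  assumes "(1 / 3) ^ k < d"
  shows "covering_number (frontier snowflake) d \<le> 3 * 4 ^ k"
proof -
  define C where "C = (\<lambda>(j, w). piece j w 0) ` ({..<3::nat} \<times> words k)"
  have "frontier snowflake \<subseteq> (\<Union>c\<in>C. ball c d)"
  proof
    fix x assume "x \<in> frontier snowflake"
    then obtain j w where w: "j < 3" "w \<in> words k" "dist x (piece j w 0) \<le> (1 / 3) ^ k"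
      using frontier_snowflake koch3_near by blast
    have "piece j w 0 \<in> C" unfolding C_def using w(1,2) by force
    then show "x \<in> (\<Union>c\<in>C. ball c d)" using w(3) assms by (force simp: dist_commute)
  qed
  then have "covering_number (frontier snowflake) d \<le> card C"
    by (intro covering_number_le) (auto simp: C_def finite_words)
  also have "\<dots> \<le> card ({..<3::nat} \<times> words k)"
    unfolding C_def by (intro card_image_le) (simp add: finite_words)
  finally show ?thesis by (simp add: card_words card_cartesian_product)
qed

lemma kmap_orhomb_disjoint:
  assumes "v \<in> lists {..<4}" "w \<in> lists {..<4}" "length v = length w" "v \<noteq> w" "x \<in> orhomb" "y \<in> orhomb"
  shows "kmap v x \<noteq> kmap w y"
  using assms(3,1,2,4)
proof (induction v w rule: list_induct2)
  case (Cons i v j w)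
  then have ij: "i < 4" "j < 4" and vw: "v \<in> lists {..<4}" "w \<in> lists {..<4}" by auto
  show ?case
  proof (cases "i = j")
    case True
    then have "kmap v x \<noteq> kmap w y" using Cons vw by auto
    then show ?thesis using True kf_eq_iff[OF ij(1)] by simp
  next
    case False
    then show ?thesis
      using kf_orhomb_disjoint[OF ij False] kmap_orhomb vw assms(5,6) by simp
  qed
qed simp

text \<open>Room is needed around the whole segment, since it is not known where on it the frontier
  is met.\<close>

lemma ball_segment_orhomb:
  assumes "z \<in> closed_segment inpt outpt"
  shows "ball z (1 / 36) \<subseteq> orhomb"
proof
  fix x assume x: "x \<in> ball z (1 / 36)"
  obtain u where u: "0 \<le> u" "u \<le> 1" "z = (1 - u) *\<^sub>R inpt + u *\<^sub>R outpt"
    using assms unfolding closed_segment_def by auto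
  have "Re z = 1 / 2 - u / 4" "sIm z = 1 / 6 - u / 3"
    unfolding u(3) by (simp_all add: inpt_def outpt_def field_simps)
  then show "x \<in> orhomb"
    using ball_coords[OF x] u(1,2) by (auto simp: orhomb_def abs_if split: if_splits)
qed

text \<open>The image of the segment from \<open>inpt\<close> to \<open>outpt\<close> leaves the
  snowflake, so every word has a frontier point whose ball of radius 3^(- k) / 36 stays in its own
  open rhombus. Distinct words need distinct centres once 2 d <= 3^(- k) / 36, hence the 72.\<close>

lemma covering_number_snowflake_ge:
  assumes d: "0 < d" "72 * d \<le> (1 / 3) ^ k"
  shows "4 ^ k \<le> covering_number (frontier snowflake) d"
proof (rule covering_number_ge[OF compact_frontier_snowflake d(1)])
  fix C assume C: "finite C" "frontier snowflake \<subseteq> (\<Union>c\<in>C. ball c d)"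
  have "\<exists>z\<in>closed_segment inpt outpt. piece 0 w z \<in> frontier snowflake" if w: "w \<in> words k" for w
  proof -
    note wl = words_lists[OF w]
    have "piece 0 w inpt \<in> piece 0 w ` ball inpt (1 / 36)" "piece 0 w outpt \<in> piece 0 w ` ball outpt (1 / 36)"
      by (auto intro!: imageI)
    then have "piece 0 w inpt \<in> snowflake" "piece 0 w outpt \<notin> snowflake"
      using snowflake_ball[OF wl zero_less_numeral] snowflake_compl_ball[OF wl zero_less_numeral] by blast+
    then have "piece 0 w ` closed_segment inpt outpt \<inter> frontier snowflake \<noteq> {}"
      by (intro connected_Int_frontier connected_piece_segment) auto
    then show ?thesis by blast
  qed
  then obtain z where z: "\<And>w. w \<in> words k \<Longrightarrow> z w \<in> closed_segment inpt outpt"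
      "\<And>w. w \<in> words k \<Longrightarrow> piece 0 w (z w) \<in> frontier snowflake" by metis
  have "\<exists>c\<in>C. dist c (piece 0 w (z w)) < d" if "w \<in> words k" for w
  proof -
    have "piece 0 w (z w) \<in> (\<Union>c\<in>C. ball c d)" using C(2) z(2)[OF that] by blast
    then show ?thesis by auto
  qed
  then obtain c where c: "\<And>w. w \<in> words k \<Longrightarrow> c w \<in> C" "\<And>w. w \<in> words k \<Longrightarrow> dist (c w) (piece 0 w (z w)) < d"
    by metis
  have "inj_on c (words k)"
  proof (rule inj_onI, rule ccontr)
    fix v w assume vw: "v \<in> words k" "w \<in> words k" "c v = c w" "v \<noteq> w"
    have "dist (piece 0 v (z v)) (piece 0 w (z w)) < 2 * d"
      using c(2)[OF vw(1)] c(2)[OF vw(2)] vw(3) dist_triangle[of "piece 0 v (z v)" "piece 0 w (z w)" "c w"]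
      by (simp add: dist_commute)
    then have "piece 0 w (z w) \<in> ball (piece 0 v (z v)) ((1 / 3) ^ k * (1 / 36))"
      using d(2) by simp
    also have "\<dots> = piece 0 v ` ball (z v) (1 / 36)"
      using piece_ball[OF words_lists[OF vw(1)], of 0] words_length[OF vw(1)] by simp
    finally obtain y where y: "y \<in> ball (z v) (1 / 36)" "piece 0 w (z w) = piece 0 v y" by blast
    then have "kmap w (z w) = kmap v y" by (simp add: piece_def side_def)
    moreover have "y \<in> orhomb" using ball_segment_orhomb[OF z(1)[OF vw(1)]] y(1) by blast
    moreover have "z w \<in> orhomb" using ball_segment_orhomb[OF z(1)[OF vw(2)]] by auto
    ultimately show False
      using kmap_orhomb_disjoint[of w v "z w" y] vw words_lists words_length by metis
  qed
  then have "card (words k) \<le> card C" using c(1) C(1) by (intro card_inj_on_le) auto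
  then show "4 ^ k \<le> card C" by (simp add: card_words)
qed

lemma log_covering_number_snowflake:
  assumes d: "0 < d" "d < 1 / 72"
  defines "N \<equiv> ln (real (covering_number (frontier snowflake) d))"
  shows "N \<le> ln 12 + ln 4 / ln 3 * (- ln d)"
    and "ln 4 / ln 3 * (- ln d) - (ln 72 / ln 3 + 1) * ln 4 \<le> N"
proof -
  have l72: "ln (72 * d) = ln 72 + ln d" using d by (simp add: ln_mult)
  \<comment> \<open>The finest level to which the lower bound applies; \<open>d < 1 / 72\<close>
    keeps the floor nonnegative, so \<open>nat\<close> does not truncate.\<close>
  define m where "m = nat \<lfloor>- ln (72 * d) / ln 3\<rfloor>"
  have "ln (72 * d) < 0" using d by simp
  then have fl: "0 \<le> - ln (72 * d) / ln 3" by (intro divide_nonneg_pos) auto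
  then have m: "real m \<le> - ln (72 * d) / ln 3" "- ln (72 * d) / ln 3 - 1 \<le> real m"
    unfolding m_def by linarith+
  have "ln (72 * d) \<le> - (real m * ln 3)" using m(1) by (simp add: field_simps)
  also have "\<dots> = ln ((1 / 3) ^ m)" by (simp add: ln_realpow ln_div)
  finally have "72 * d \<le> (1 / 3) ^ m" using d by (subst (asm) ln_le_cancel_iff) auto
  then have ge: "4 ^ m \<le> covering_number (frontier snowflake) d"
    using covering_number_snowflake_ge d by blast
  then have pos: "0 < covering_number (frontier snowflake) d"
    by (metis less_le_trans zero_less_power zero_less_numeral)
  have "(- ln (72 * d) / ln 3 - 1) * ln 4 \<le> real m * ln 4"
    using m(2) by (intro mult_right_mono) auto
  also have "\<dots> = ln (4 ^ m)" by (simp add: ln_realpow)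
  also have "\<dots> \<le> N"
  proof -
    have "real (4 ^ m) \<le> real (covering_number (frontier snowflake) d)" using ge by (simp only: of_nat_le_iff)
    then show ?thesis unfolding N_def by (subst ln_le_cancel_iff) (use pos in auto)
  qed
  finally show "ln 4 / ln 3 * (- ln d) - (ln 72 / ln 3 + 1) * ln 4 \<le> N"
    unfolding l72 by (simp add: field_simps)
  \<comment> \<open>The successor makes 3^(- k) < d strict, as the upper bound requires.\<close>
  define k where "k = Suc (nat \<lfloor>- ln d / ln 3\<rfloor>)"
  have "ln d < 0" using d by simp
  then have "0 \<le> - ln d / ln 3" by (intro divide_nonneg_pos) auto
  then have k: "- ln d / ln 3 < real k" "real k \<le> - ln d / ln 3 + 1"
    unfolding k_def by linarith+
  have "ln ((1 / 3) ^ k) = - (real k * ln 3)" by (simp add: ln_realpow ln_div)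
  also have "\<dots> < ln d" using k(1) by (simp add: field_simps)
  finally have "(1 / 3) ^ k < d" using d by (subst (asm) ln_less_cancel_iff) auto
  then have "real (covering_number (frontier snowflake) d) \<le> real (3 * 4 ^ k)"
    using covering_number_snowflake_le by (simp only: of_nat_le_iff)
  then have "N \<le> ln (3 * 4 ^ k)" unfolding N_def by (subst ln_le_cancel_iff) (use pos in auto)
  also have "\<dots> = ln 3 + real k * ln 4" by (simp add: ln_mult ln_realpow)
  also have "\<dots> \<le> ln 3 + (- ln d / ln 3 + 1) * ln 4" using k(2) by (intro add_left_mono mult_right_mono) auto
  also have "\<dots> = ln (3 * 4) + ln 4 / ln 3 * (- ln d)"
    by (subst ln_mult) (simp_all add: field_simps)
  finally show "N \<le> ln 12 + ln 4 / ln 3 * (- ln d)" by simp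
qed

text \<open>Both logarithmic bounds differ from (ln 4 / ln 3) * (- ln d) by constants, which vanish
  on division by - ln d.\<close>

lemma box_dimension_snowflake:
  "((\<lambda>d. ln (real (covering_number (frontier snowflake) d)) / (- ln d)) \<longlongrightarrow> ln 4 / ln 3) (at_right 0)"
proof (rule tendsto_sandwich)
  have top: "filterlim (\<lambda>d :: real. - ln d) at_infinity (at_right 0)"
    using ln_at_0 by (intro filterlim_at_top_imp_at_infinity) (simp add: filterlim_uminus_at_bot)
  have lim: "((\<lambda>d :: real. ln 4 / ln 3 + c / (- ln d)) \<longlongrightarrow> ln 4 / ln 3 + 0) (at_right 0)" for c :: real
    by (intro tendsto_add tendsto_const tendsto_divide_0[OF tendsto_const top])
  show "((\<lambda>d :: real. ln 4 / ln 3 + (- ((ln 72 / ln 3 + 1) * ln 4)) / (- ln d)) \<longlongrightarrow> ln 4 / ln 3) (at_right 0)"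
    using lim[of "- ((ln 72 / ln 3 + 1) * ln 4)"] by simp
  show "((\<lambda>d :: real. ln 4 / ln 3 + ln 12 / (- ln d)) \<longlongrightarrow> ln 4 / ln 3) (at_right 0)"
    using lim[of "ln 12"] by simp
  have quot: "0 < x \<Longrightarrow> a * x - c \<le> N \<Longrightarrow> a + (- c) / x \<le> N / x"
    "0 < x \<Longrightarrow> N \<le> c + a * x \<Longrightarrow> N / x \<le> a + c / x" for a c x N :: real
    using divide_right_mono[of "a * x - c" N x] divide_right_mono[of N "c + a * x" x]
    by (simp_all add: diff_divide_distrib add_divide_distrib)
  have ev: "\<forall>\<^sub>F d in at_right (0::real). 0 < d \<and> d < 1 / 72"
    by (auto simp: eventually_at_right_less intro!: eventually_at_rightI[of 0 "1/72"])
  show "\<forall>\<^sub>F d in at_right 0. ln 4 / ln 3 + (- ((ln 72 / ln 3 + 1) * ln 4)) / (- ln d)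
      \<le> ln (real (covering_number (frontier snowflake) d)) / (- ln d)"
    using ev
  proof eventually_elim
    case (elim d)
    then show ?case by (intro quot log_covering_number_snowflake) (auto simp del: ln_less_zero_iff intro!: ln_less_zero)
  qed
  show "\<forall>\<^sub>F d in at_right 0. ln (real (covering_number (frontier snowflake) d)) / (- ln d)
      \<le> ln 4 / ln 3 + ln 12 / (- ln d)"
    using ev
  proof eventually_elim
    case (elim d)
    then show ?case by (intro quot log_covering_number_snowflake) (auto simp del: ln_less_zero_iff intro!: ln_less_zero)
  qed
qed

text \<open>Equivalently, the critical exponent lies strictly between 0 and 1, so the supremum in
  the fractal dimension runs over a nonempty open interval ending there.\<close>

lemma ln4_ln3_bounds: "1 < ln 4 / ln (3 :: real)" "ln 4 / ln (3 :: real) < 2"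
proof -
  have "ln 4 < ln (3 ^ 2 :: real)" by simp
  also have "\<dots> = 2 * ln 3" by (subst ln_realpow) auto
  finally show "ln 4 / ln (3 :: real) < 2" by (simp add: divide_less_eq)
  show "1 < ln 4 / ln (3 :: real)" by (simp add: less_divide_eq)
qed

theorem theorem1p1:
  shows "(\<forall>s. 0 < s \<and> s < 2 - ln 4 / ln 3 \<longrightarrow> s_perimeter s snowflake < \<infinity>)
       \<and> (\<forall>s. 2 - ln 4 / ln 3 \<le> s \<and> s < 1 \<longrightarrow> s_perimeter s snowflake = \<infinity>)
       \<and> measure_boundary snowflake \<noteq> {}
       \<and> fractal_dim snowflake = ln 4 / ln 3
       \<and> lower_minkowski_dim (frontier snowflake) = ereal (ln 4 / ln 3)
       \<and> upper_minkowski_dim (frontier snowflake) = ereal (ln 4 / ln 3)"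
proof (intro conjI)
  note b = ln4_ln3_bounds
  show fin: "\<forall>s. 0 < s \<and> s < 2 - ln 4 / ln 3 \<longrightarrow> s_perimeter s snowflake < \<infinity>"
    using snowflake_perimeter_finite by blast
  show inf: "\<forall>s. 2 - ln 4 / ln 3 \<le> s \<and> s < 1 \<longrightarrow> s_perimeter s snowflake = \<infinity>"
  proof (intro allI impI)
    fix s :: real assume s: "2 - ln 4 / ln 3 \<le> s \<and> s < 1"
    then have "0 < s" using b by linarith
    then show "s_perimeter s snowflake = \<infinity>" using snowflake_perimeter_infinite s by blast
  qed
  have "piece 0 [] 0 \<in> koch3" by (rule piece_0_in_koch3[of 0 "[]" 0]) (auto simp: words_def)
  then show "measure_boundary snowflake \<noteq> {}" using measure_boundary_snowflake by blast
  have "{s. 0 < s \<and> s < 1 \<and> s_perimeter s snowflake < \<infinity>} = {0<..<2 - ln 4 / ln 3}"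
  proof (intro equalityI subsetI)
    fix s assume s: "s \<in> {s. 0 < s \<and> s < 1 \<and> s_perimeter s snowflake < \<infinity>}"
    then have "s < 2 - ln 4 / ln 3" using inf by (metis (mono_tags, lifting) mem_Collect_eq not_le order_less_irrefl)
    then show "s \<in> {0<..<2 - ln 4 / ln 3}" using s by simp
  next
    fix s :: real assume s: "s \<in> {0<..<2 - ln 4 / ln 3}"
    then have "s < 1" using b(1) unfolding greaterThanLessThan_iff by linarith
    then show "s \<in> {s. 0 < s \<and> s < 1 \<and> s_perimeter s snowflake < \<infinity>}" using s fin by auto
  qed
  then show "fractal_dim snowflake = ln 4 / ln 3"
    using b(2) by (simp add: fractal_dim_def fractal_dim_in_def local_s_perimeter_UNIV)
  have lim: "((\<lambda>d. ereal (ln (real (covering_number (frontier snowflake) d)) / (- ln d))) \<longlongrightarrow> ereal (ln 4 / ln 3)) (at_right 0)"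
    using box_dimension_snowflake by (rule tendsto_ereal)
  show "lower_minkowski_dim (frontier snowflake) = ereal (ln 4 / ln 3)"
    unfolding lower_minkowski_dim_def by (rule lim_imp_Liminf[OF _ lim]) simp
  show "upper_minkowski_dim (frontier snowflake) = ereal (ln 4 / ln 3)"
    unfolding upper_minkowski_dim_def by (rule lim_imp_Limsup[OF _ lim]) simp
qed

end
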